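(* Let $r\ge2$, let $h,\widetilde h$ be convergent power series in one variable with $h(0)=h'(0)=0$ and $\widetilde h(0)=\widetilde h'(0)=0$, and let $(\rho,\phi)$ be an isomorphism from $(\mathcal{G}_S,\mathcal{B}_{h,S})$ to $(\mathcal{G}_{\widetilde S},\mathcal{B}_{\widetilde h,\widetilde S})$ with $A_{i,i}=1$ for all $i$, as defined in the context. Identify the $\widetilde e_j$ with elements of $H=\bigoplus_{j=0}^r\mathbb{C}e_j$ by $e_i=\sum_{j=0}^iA_{i,j}\widetilde e_j$, and let $g_1,\dots,g_r,\widetilde g\in\mathcal{O}_S$ be the functions attached to $\mathcal{B}_{h,S}$ and the basis $(\widetilde e_j)$ as in the context. Then there are equalities in $\mathcal{O}_S$ (as germs at $0$): $$g_j=\rho^*\widetilde s_j\quad(j=1,\dots,r),\qquad \widetilde g=\rho^*\widetilde h,$$ where $\widetilde h=\widetilde h(\widetilde s_1)$ is regarded as a function on $\widetilde S$.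
   Context: For a complex manifold $S$, $\mathcal{O}_S\{\!\{\partial_t^{-1}\}\!\}$ denotes the ring of series $\sum_{k\ge 0}g_k\partial_t^{-k}$ $(g_k\in\mathcal{O}_S)$ such that $\sum_k g_k x^k/k!$ is convergent (near $x=0$); for $S$ a point this is $\mathbb{C}\{\!\{\partial_t^{-1}\}\!\}$. Adding $[\partial_t]$ means inverting $\partial_t^{-1}$. Everything is considered for germs at $0$, i.e. after shrinking $S$. Let $H=\bigoplus_{j=0}^r\mathbb{C}e_j$. Let $S$ be a sufficiently small open polydisk about $0$ in $\mathbb{C}^r$ with coordinates $s_1,\dots,s_r$, and let $\mathcal{G}_S=\bigoplus_{j=0}^r\mathcal{O}_S\{\!\{\partial_t^{-1}\}\!\}[\partial_t]\,e_j$ with $t$ acting $\mathcal{O}_S$-linearly by $t\,\partial_t^{-k}e_j=(k+1)\partial_t^{-k-1}e_j$ for all $k\in\mathbb{Z}$, $0\le j\le r$, and with $\partial_{s_i}e_j=0$ for all $i,j$. For $h\in\mathbb{C}\{s_1\}$ with $h(0)=h'(0)=0$ put $$v_0=e_0+\sum_{j=1}^r s_j\partial_t^{1-j}e_j+h(s_1)e_2,\qquad v_j=\partial_t^{-1}\partial_{s_j}v_0\ (1\le j\le r),$$ and $\mathcal{B}_{h,S}=\sum_{j=0}^r\mathcal{O}_S\{\!\{\partial_t^{-1}\}\!\}v_j\subset\mathcal{G}_S$; it is stable under $t$, $\partial_t^{-1}$, $\partial_t^{-1}\partial_{s_i}$. Let $\widetilde S$ be a second such polydisk with coordinates $\widetilde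 s_1,\dots,\widetilde s_r$, and define $\mathcal{G}_{\widetilde S}$ and $\mathcal{B}_{\widetilde h,\widetilde S}$ in the same way, with $h,e_j,s_i$ replaced by $\widetilde h,\widetilde e_j,\widetilde s_i$. An isomorphism from $(\mathcal{G}_S,\mathcal{B}_{h,S})$ to $(\mathcal{G}_{\widetilde S},\mathcal{B}_{\widetilde h,\widetilde S})$ is a pair $(\rho,\phi)$, where $\rho:(S,0)\to(\widetilde S,0)$ is an isomorphism of germs of complex manifolds and $\phi:\mathcal{G}_S\to\rho^*\mathcal{G}_{\widetilde S}$ is an isomorphism of $\mathcal{O}_S\{\!\{\partial_t^{-1}\}\!\}[\partial_t]$-modules compatible with the actions of $t$ and $\partial_{s_i}$ and with $\phi(\mathcal{B}_{h,S})=\rho^*\mathcal{B}_{\widetilde h,\widetilde S}$. Such $\phi$ is determined by the constant matrix $(A_{i,j})$, $A_{i,j}\in\mathbb{C}$, with $\phi(e_i)=\sum_jA_{i,j}\widetilde e_j$, and one has $A_{i,j}=0$ for $i<j$. It is assumed throughout that $A_{i,i}=1$ for all $i$. After identifying $\widetilde e_j$ with elements of $H$ (so that $(\widetilde e_j)$ is a basis of $H$), let $v'_0\in\mathcal{B}_{h,S}$ be the unique element (after shrinking $S$) such that $$v'_0-\widetilde e_0\in\bigoplus_{k=1}^r\ \bigoplus_{i=k}^r\mathcal{O}_S\,\partial_t^{1-k}\widetilde e_i .$$ (It is the canonical generator attached to $\widetilde e_0$ and the opposite filtration $U^pH=\bigoplus_{i\ge p}\mathbb{C}\widetilde e_i$.)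 Expanding elements of $\mathcal{G}_S$ in the elements $\partial_t^{1-k}\widetilde e_i$ $(k\in\mathbb{Z},0\le i\le r)$ with coefficients in $\mathcal{O}_S$, define $g_j$ to be the coefficient of $\partial_t^{1-j}\widetilde e_j$ in $v'_0$ $(1\le j\le r)$, and $\widetilde g$ to be the coefficient of $\widetilde e_2$ in $v'_0$. *)

theory Defs
  imports
    "HOL-Analysis.Analysis"
    "HOL-Computational_Algebra.Formal_Laurent_Series"
begin

section \<open>Germs at the origin of \<open>\<complex>\<^sup>r\<close>\<close>

text \<open>Throughout, \<open>r = CARD('n)\<close>. The coordinates of a point \<open>s :: complex ^ 'n\<close> are numbered
  \<open>s\<^sub>1, \<dots>, s\<^sub>r\<close> by an enumeration \<open>idx\<close> of the index type, fixed once and for all.\<close>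

definition idx :: "nat \<Rightarrow> 'n::finite" where
  "idx = (SOME f. bij_betw f {1..CARD('n)} UNIV)"

lemma bij_betw_idx: "bij_betw (idx :: nat \<Rightarrow> 'n::finite) {1..CARD('n)} UNIV"
proof -
  have "\<exists>f. bij_betw f {1..CARD('n)} (UNIV :: 'n set)"
    by (rule finite_same_card_bij) auto
  then show ?thesis
    unfolding idx_def by (rule someI_ex)
qed

text \<open>The type below consists of germs of arbitrary functions, which makes it a commutative ring
  with total operations; the local ring of the complex manifold is its subset \<open>hol_germs\<close>.\<close>

quotient_type (overloaded) 'n germ =
  "complex ^ 'n::finite \<Rightarrow> complex" / "\<lambda>f g. \<forall>\<^sub>F s in nhds 0. f s = g s"
  morphisms rep_germ to_germ
proof (rule equivpI)
  show "reflp (\<lambda>f g :: complex ^ 'n \<Rightarrow> complex. \<forall>\<^sub>F s in nhds 0. f s = g s)"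
    by (simp add: reflp_def)
  show "symp (\<lambda>f g :: complex ^ 'n \<Rightarrow> complex. \<forall>\<^sub>F s in nhds 0. f s = g s)"
    by (simp add: symp_def eq_commute)
  show "transp (\<lambda>f g :: complex ^ 'n \<Rightarrow> complex. \<forall>\<^sub>F s in nhds 0. f s = g s)"
    unfolding transp_def by (auto elim: eventually_elim2)
qed

instantiation germ :: (finite) comm_ring_1
begin

lift_definition zero_germ :: "'a germ" is "\<lambda>_. 0" .
lift_definition one_germ :: "'a germ" is "\<lambda>_. 1" .
lift_definition plus_germ :: "'a germ \<Rightarrow> 'a germ \<Rightarrow> 'a germ" is "\<lambda>f g s. f s + g s"
  by (auto elim: eventually_elim2)
lift_definition minus_germ :: "'a germ \<Rightarrow> 'a germ \<Rightarrow> 'a germ" is "\<lambda>f g s. f s - g s"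
  by (auto elim: eventually_elim2)
lift_definition uminus_germ :: "'a germ \<Rightarrow> 'a germ" is "\<lambda>f s. - f s"
  by (auto elim: eventually_mono)
lift_definition times_germ :: "'a germ \<Rightarrow> 'a germ \<Rightarrow> 'a germ" is "\<lambda>f g s. f s * g s"
  by (auto elim: eventually_elim2)

instance
proof
  show "(0 :: 'a germ) \<noteq> 1"
    by transfer simp
qed (transfer; simp add: algebra_simps)+

end

definition hol_on :: "(complex ^ 'n::finite) set \<Rightarrow> (complex ^ 'n \<Rightarrow> complex) \<Rightarrow> bool" where
  "hol_on U f \<longleftrightarrow>
     (\<forall>s\<in>U. \<exists>c. (f has_derivative (\<lambda>v. \<Sum>i\<in>UNIV. c i * vec_nth v i)) (at s))"

definition hol_germs :: "('n::finite) germ set" where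
  "hol_germs = {to_germ f | f U. open U \<and> 0 \<in> U \<and> hol_on U f}"

definition coord :: "nat \<Rightarrow> ('n::finite) germ" where
  "coord j = to_germ (\<lambda>s. vec_nth s (idx j))"

definition series_germ :: "complex fps \<Rightarrow> ('n::finite) germ" where
  "series_germ h = to_germ (\<lambda>s. eval_fps h (vec_nth s (idx 1)))"

lift_definition germ_pd :: "nat \<Rightarrow> ('n::finite) germ \<Rightarrow> 'n germ"
  is "\<lambda>i f s. deriv (\<lambda>z. f (s + axis (idx i) z)) 0"
proof -
  fix i and f g :: "complex ^ 'n \<Rightarrow> complex"
  assume "\<forall>\<^sub>F s in nhds 0. f s = g s"
  then have "\<forall>\<^sub>F s in nhds 0. \<forall>\<^sub>F s' in nhds s. f s' = g s'"
    by (simp add: eventually_eventually)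
  then show "\<forall>\<^sub>F s in nhds 0.
      deriv (\<lambda>z. f (s + axis (idx i) z)) 0 = deriv (\<lambda>z. g (s + axis (idx i) z)) 0"
  proof (rule eventually_mono)
    fix s :: "complex ^ 'n"
    assume ev: "\<forall>\<^sub>F s' in nhds s. f s' = g s'"
    have "continuous_on UNIV (\<lambda>z :: complex. s + axis (idx i) z)"
      unfolding axis_def
    proof (intro continuous_on_add continuous_on_const continuous_on_vec_lambda)
      show "continuous_on UNIV (\<lambda>z :: complex. if l = idx i then z else 0)" for l :: 'n
        by (cases "l = idx i") (simp_all add: continuous_on_id)
    qed
    then have "isCont (\<lambda>z :: complex. s + axis (idx i) z) 0"
      by (simp add: continuous_on_eq_continuous_at)
    then have "filterlim (\<lambda>z :: complex. s + axis (idx i) z) (nhds s) (nhds 0)"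
      using tendsto_at_iff_tendsto_nhds[of "\<lambda>z. s + axis (idx i) z" 0]
      by (simp add: isCont_def axis_def zero_vec_def[symmetric])
    with ev have "\<forall>\<^sub>F z in nhds 0. f (s + axis (idx i) z) = g (s + axis (idx i) z)"
      by (rule eventually_compose_filterlim)
    then show "deriv (\<lambda>z. f (s + axis (idx i) z)) 0 = deriv (\<lambda>z. g (s + axis (idx i) z)) 0"
      by (rule deriv_cong_ev) simp
  qed
qed

text \<open>Pullback along a map germ \<open>\<rho> : (\<complex>\<^sup>r, 0) \<rightarrow> (\<complex>\<^sup>r, 0)\<close>. The limit is along \<open>nhds 0\<close>,
  so the condition says that \<open>\<rho> 0 = 0\<close> and that \<open>\<rho>\<close> is continuous at \<open>0\<close>.\<close>

lift_definition germ_pullback ::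
    "(complex ^ 'n \<Rightarrow> complex ^ 'n) \<Rightarrow> ('n::finite) germ \<Rightarrow> 'n germ"
  is "\<lambda>\<rho> f. if filterlim \<rho> (nhds 0) (nhds 0) then (\<lambda>s. f (\<rho> s)) else (\<lambda>_. 0)"
  by (auto simp: filterlim_iff)

definition germ_biholomorphism :: "(complex ^ 'n \<Rightarrow> complex ^ 'n::finite) \<Rightarrow> bool" where
  "germ_biholomorphism \<rho> \<longleftrightarrow> \<rho> 0 = 0 \<and>
     (\<exists>U V \<sigma>. open U \<and> 0 \<in> U \<and> open V \<and> 0 \<in> V \<and> homeomorphism U V \<rho> \<sigma> \<and>
        (\<forall>i. hol_on U (\<lambda>s. vec_nth (\<rho> s) i)) \<and> (\<forall>i. hol_on V (\<lambda>s. vec_nth (\<sigma> s) i)))"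

section \<open>Series in \<open>\<partial>\<^sub>t\<^sup>-\<^sup>1\<close>\<close>

text \<open>A series in \<open>\<partial>\<^sub>t\<^sup>-\<^sup>1\<close> with germ coefficients is a formal Laurent series whose variable
  \<^const>\<open>fls_X\<close> stands for \<open>\<partial>\<^sub>t\<^sup>-\<^sup>1\<close>: \<open>fls_nth a k\<close> is the coefficient of \<open>\<partial>\<^sub>t\<^sup>-\<^sup>k\<close>.
  Convergence of \<open>\<Sum>\<^sub>k g\<^sub>k x\<^sup>k / k!\<close> means that it represents a germ of a holomorphic function of
  \<open>(s, x)\<close>, so all \<open>g\<^sub>k\<close> live on a common neighbourhood and the convergence is uniform there.\<close>

definition conv_series :: "('n::finite) germ fls set" where
  "conv_series = {a. (\<forall>n<0. fls_nth a n = 0) \<and>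
     (\<exists>U \<epsilon> g. open U \<and> 0 \<in> U \<and> \<epsilon> > 0 \<and>
        (\<forall>k. hol_on U (g k) \<and> fls_nth a (int k) = to_germ (g k)) \<and>
        uniformly_convergent_on (U \<times> ball 0 \<epsilon>)
          (\<lambda>N (s, x :: complex). \<Sum>k<N. g k s * x ^ k / fact k))}"

definition conv_laurent :: "('n::finite) germ fls set" where
  "conv_laurent = {a. \<exists>N::nat. fls_X ^ N * a \<in> conv_series}"

definition Dt :: "int \<Rightarrow> ('n::finite) germ fls" where
  "Dt k = fls_X_intpow (- k)"

definition cst :: "complex \<Rightarrow> ('n::finite) germ fls" where
  "cst z = fls_const (to_germ (\<lambda>_. z))"

definition fls_map :: "('a \<Rightarrow> 'a) \<Rightarrow> 'a::zero fls \<Rightarrow> 'a fls" where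
  "fls_map f a = Abs_fls (\<lambda>n. f (fls_nth a n))"

lemma fls_nth_fls_map:
  assumes "f 0 = 0"
  shows "fls_nth (fls_map f a) n = f (fls_nth a n)"
proof -
  have "\<forall>n<fls_subdegree a. f (fls_nth a n) = 0"
    using assms by simp
  then show ?thesis
    unfolding fls_map_def by (rule nth_Abs_fls_lower_bound)
qed

lemma germ_pd_0 [simp]: "germ_pd i 0 = 0"
  by transfer simp

lemma germ_pullback_0 [simp]: "germ_pullback \<rho> 0 = 0"
  by transfer simp

section \<open>The Gauss--Manin systems and the Brieskorn modules\<close>

text \<open>An element \<open>\<Sum>\<^sub>j u\<^sub>j e\<^sub>j\<close> of the free module on \<open>e\<^sub>0, \<dots>, e\<^sub>r\<close> is the sequence of its
  components, which vanish beyond \<open>r\<close>; \<open>hframe j\<close> is \<open>e\<^sub>j\<close>. The lemma \<open>fls_nth_t_act\<close> is the rule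
  \<open>t \<partial>\<^sub>t\<^sup>-\<^sup>k e\<^sub>j = (k + 1) \<partial>\<^sub>t\<^sup>-\<^sup>k\<^sup>-\<^sup>1 e\<^sub>j\<close>.\<close>

type_synonym 'n vect = "nat \<Rightarrow> 'n germ fls"

definition GM :: "('n::finite) vect set" where
  "GM = {u. (\<forall>j. u j \<in> conv_laurent) \<and> (\<forall>j>CARD('n). u j = 0)}"

definition hframe :: "nat \<Rightarrow> ('n::finite) vect" where
  "hframe j = (\<lambda>l. if l = j then 1 else 0)"

definition comb :: "(nat \<Rightarrow> 'n germ fls) \<Rightarrow> (nat \<Rightarrow> 'n vect) \<Rightarrow> ('n::finite) vect" where
  "comb c b = (\<lambda>l. \<Sum>j\<le>CARD('n). c j * b j l)"

definition t_act :: "('n::finite) vect \<Rightarrow> 'n vect" where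
  "t_act u = (\<lambda>j. fls_X * fls_deriv (fls_X * u j))"

lemma fls_nth_t_act: "fls_nth (t_act u j) (k + 1) = of_int (k + 1) * fls_nth (u j) k"
  by (simp add: t_act_def fls_X_times_conv_shift)

text \<open>The \<open>e\<^sub>j\<close> are horizontal, so \<open>\<partial>\<close> acts on coefficients. The same formula gives the pulled
  back connection on \<open>\<rho>\<^sup>*\<G>\<close>, since the frame \<open>\<rho>\<^sup>*e\<^sub>j\<close> is horizontal as well.\<close>

definition pd_act :: "nat \<Rightarrow> ('n::finite) vect \<Rightarrow> 'n vect" where
  "pd_act i u = (\<lambda>j. fls_map (germ_pd i) (u j))"

definition vect_pullback :: "(complex ^ 'n \<Rightarrow> complex ^ 'n) \<Rightarrow> ('n::finite) vect \<Rightarrow> 'n vect" where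
  "vect_pullback \<rho> u = (\<lambda>j. fls_map (germ_pullback \<rho>) (u j))"

definition v0 :: "complex fps \<Rightarrow> ('n::finite) vect" where
  "v0 h = (\<lambda>l. hframe 0 l + (\<Sum>j=1..CARD('n). fls_const (coord j) * Dt (1 - int j) * hframe j l)
                 + fls_const (series_germ h) * hframe 2 l)"

definition vgen :: "complex fps \<Rightarrow> nat \<Rightarrow> ('n::finite) vect" where
  "vgen h j = (if j = 0 then v0 h else (\<lambda>l. Dt (- 1) * pd_act j (v0 h) l))"

definition Brieskorn :: "complex fps \<Rightarrow> ('n::finite) vect set" where
  "Brieskorn h = {comb a (vgen h) | a. \<forall>j\<le>CARD('n). a j \<in> conv_series}"

definition series_span :: "('n::finite) vect set \<Rightarrow> 'n vect set" where
  "series_span X = {(\<lambda>l. \<Sum>x\<in>F. a x * x l) | F a. finite F \<and> F \<subseteq> X \<and> (\<forall>x\<in>F. a x \<in> conv_series)}"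

text \<open>\<open>\<rho>\<^sup>*\<B>\<close> is the submodule generated by the pulled back sections. The module \<open>\<rho>\<^sup>*\<G>\<close> is
  free on the \<open>\<rho>\<^sup>*e\<^sub>j\<close>, hence again \<^const>\<open>GM\<close>.\<close>

definition Brieskorn_pullback ::
    "(complex ^ 'n \<Rightarrow> complex ^ 'n) \<Rightarrow> complex fps \<Rightarrow> ('n::finite) vect set" where
  "Brieskorn_pullback \<rho> h = series_span (vect_pullback \<rho> ` Brieskorn h)"

definition GM_isomorphism ::
    "complex fps \<Rightarrow> complex fps \<Rightarrow> (complex ^ 'n \<Rightarrow> complex ^ 'n) \<Rightarrow>
     (('n::finite) vect \<Rightarrow> 'n vect) \<Rightarrow> bool" where
  "GM_isomorphism h h' \<rho> \<phi> \<longleftrightarrow>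
     germ_biholomorphism \<rho> \<and>
     bij_betw \<phi> GM GM \<and>
     (\<forall>u\<in>GM. \<forall>w\<in>GM. \<phi> (\<lambda>l. u l + w l) = (\<lambda>l. \<phi> u l + \<phi> w l)) \<and>
     (\<forall>a\<in>conv_laurent. \<forall>u\<in>GM. \<phi> (\<lambda>l. a * u l) = (\<lambda>l. a * \<phi> u l)) \<and>
     (\<forall>u\<in>GM. \<phi> (t_act u) = t_act (\<phi> u)) \<and>
     (\<forall>i\<in>{1..CARD('n)}. \<forall>u\<in>GM. \<phi> (pd_act i u) = pd_act i (\<phi> u)) \<and>
     \<phi> ` Brieskorn h = Brieskorn_pullback \<rho> h'"

definition frame_matrix :: "(('n::finite) vect \<Rightarrow> 'n vect) \<Rightarrow> nat \<Rightarrow> nat \<Rightarrow> complex" where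
  "frame_matrix \<phi> =
     (THE A. (\<forall>i j. i > CARD('n) \<or> j > CARD('n) \<longrightarrow> A i j = 0) \<and>
             (\<forall>i\<le>CARD('n). \<phi> (hframe i) = comb (\<lambda>j. cst (A i j)) hframe))"

section \<open>The canonical generator\<close>

definition H_space :: "nat \<Rightarrow> (nat \<Rightarrow> complex) set" where
  "H_space r = {x. \<forall>l>r. x l = 0}"

text \<open>\<open>b\<^sub>0, \<dots>, b\<^sub>r\<close> is a second family in \<open>H\<close> with \<open>e\<^sub>i = \<Sum>\<^sub>j\<^sub>\<le>\<^sub>i A\<^sub>i\<^sub>j b\<^sub>j\<close>, where \<open>e\<^sub>i\<close> is the \<open>i\<close>-th
  unit vector.\<close>

definition H_basis_change :: "nat \<Rightarrow> (nat \<Rightarrow> nat \<Rightarrow> complex) \<Rightarrow> (nat \<Rightarrow> nat \<Rightarrow> complex) \<Rightarrow> bool" where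
  "H_basis_change r A b \<longleftrightarrow> (\<forall>j\<le>r. b j \<in> H_space r) \<and>
     (\<forall>i\<le>r. (\<lambda>l. if l = i then 1 else 0) = (\<lambda>l. \<Sum>j\<le>i. A i j * b j l))"

definition H_vect :: "(nat \<Rightarrow> complex) \<Rightarrow> ('n::finite) vect" where
  "H_vect x = (\<lambda>l. cst (x l))"

text \<open>For the opposite filtration \<open>U\<^sup>p H\<close> spanned by the \<open>b\<^sub>i\<close> with \<open>i \<ge> p\<close>.\<close>

definition canonical_generator ::
    "complex fps \<Rightarrow> (nat \<Rightarrow> nat \<Rightarrow> complex) \<Rightarrow> ('n::finite) vect" where
  "canonical_generator h b =
     (THE v. v \<in> Brieskorn h \<and>
        (\<exists>c. (\<forall>k\<in>{1..CARD('n)}. \<forall>i\<in>{k..CARD('n)}. c k i \<in> hol_germs) \<and>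
             (\<forall>l. v l - H_vect (b 0) l =
                (\<Sum>k=1..CARD('n). \<Sum>i=k..CARD('n).
                   fls_const (c k i) * Dt (1 - int k) * H_vect (b i) l))))"

text \<open>The coefficient of \<open>\<partial>\<^sub>t\<^sup>m b\<^sub>j\<close> in the expansion of \<open>u\<close> with respect to the basis \<open>b\<close>.\<close>

definition frame_coeff :: "(nat \<Rightarrow> nat \<Rightarrow> complex) \<Rightarrow> ('n::finite) vect \<Rightarrow> int \<Rightarrow> nat \<Rightarrow> 'n germ" where
  "frame_coeff b u m j =
     fls_nth ((THE c. (\<forall>i>CARD('n). c i = 0) \<and> u = comb c (\<lambda>i. H_vect (b i))) j) (- m)"

end

theory Submission
  imports Defs
begin

text \<open>The isomorphism \<open>\<phi>\<close> carries the normal form that defines the canonical generator to the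
  shape of the section \<open>v\<^sub>0\<close> of the target, so the canonical generator is \<open>\<phi>\<^sup>-\<^sup>1(\<rho>\<^sup>*v\<^sub>0)\<close>, and its
  coefficients are those of \<open>\<rho>\<^sup>*v\<^sub>0\<close>, namely \<open>\<rho>\<^sup>*s\<^sub>j\<close> and \<open>\<rho>\<^sup>*h\<^sub>2\<close>.

  In detail, \<open>\<phi>(e\<^sub>i)\<close> is annihilated by the \<open>\<partial>\<^sub>s\<close> and satisfies \<open>t u = \<partial>\<^sub>t\<^sup>-\<^sup>1 u\<close>, hence it is a constant
  combination of the frame (\<open>horizontal_imp_constant\<close>). Its matrix \<open>A\<close> is lower triangular: at
  \<open>s = 0\<close> both Brieskorn modules specialize to the span of the \<open>\<partial>\<^sub>t\<^sup>-\<^sup>j e\<^sub>j\<close>, and \<open>\<rho>\<close> fixes the origin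
  (\<open>frame_matrix_lower_triangular\<close>). With \<open>A\<^sub>i\<^sub>i = 1\<close> the relations between \<open>b\<close> and the unit vectors say
  that \<open>\<phi>(b\<^sub>i) = e\<^sub>i\<close> (\<open>\<phi>_B\<close>).

  The section \<open>\<rho>\<^sup>*v\<^sub>0 = e\<^sub>0 + \<Sum>\<^sub>j \<rho>\<^sup>*s\<^sub>j \<partial>\<^sub>t\<^sup>1\<^sup>-\<^sup>j e\<^sub>j + \<rho>\<^sup>*h\<^sub>2 e\<^sub>2\<close> is therefore the image of the combination
  of the \<open>b\<^sub>i\<close> with the same coefficients. This combination is in the Brieskorn module, since \<open>\<phi>\<close>
  identifies the two modules, and it is visibly a normal form. Only one section of the Brieskorn
  module is a normal form: the generators \<open>\<rho>\<^sup>*v\<^sub>j\<close> are triangular with diagonal \<open>\<partial>\<^sub>t\<^sup>-\<^sup>j\<close>, so a section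
  of the pulled back module whose \<open>l\<close>-th component is a polynomial in \<open>\<partial>\<^sub>t\<^sup>-\<^sup>1\<close> of degree less than \<open>l\<close>
  is zero (\<open>Brieskorn_pullback_eqI\<close>).

  Since \<open>\<phi>\<close> is only linear over convergent series, these arguments use that such series form a ring,
  which is proved by means of the growth condition \<open>|g\<^sub>k| \<le> M C\<^sup>k k!\<close>.\<close>

no_notation fps_nth (infixl "$" 75)

section \<open>Holomorphic germs\<close>

lemma hol_on_subset: "hol_on U f \<Longrightarrow> V \<subseteq> U \<Longrightarrow> hol_on V f"
  unfolding hol_on_def by blast

lemma hol_on_const: "hol_on U (\<lambda>_. c)"
  unfolding hol_on_def by (auto intro!: exI[of _ "\<lambda>_. 0"])

lemma has_derivative_component:
  "((\<lambda>s :: complex ^ 'n::finite. s $ j) has_derivative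
    (\<lambda>v. \<Sum>i\<in>UNIV. (if i = j then 1 else 0) * v $ i)) (at s)"
proof -
  have "(\<lambda>v :: complex ^ 'n. v $ j) = (\<lambda>v. \<Sum>i\<in>UNIV. (if i = j then 1 else 0) * v $ i)"
    by (auto simp: if_distrib[of "\<lambda>x. x * _"] cong: if_cong)
  moreover have "((\<lambda>s :: complex ^ 'n. s $ j) has_derivative (\<lambda>v. v $ j)) (at s)"
    by (rule bounded_linear_imp_has_derivative) (rule bounded_linear_vec_nth)
  ultimately show ?thesis
    by simp
qed

lemma hol_on_component: "hol_on U (\<lambda>s :: complex ^ 'n::finite. s $ j)"
  unfolding hol_on_def by (auto intro!: exI has_derivative_component)

lemma hol_on_add:
  assumes "hol_on U f" "hol_on U g"
  shows "hol_on U (\<lambda>s. f s + g s)"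
  unfolding hol_on_def
proof
  fix s assume "s \<in> U"
  with assms obtain c d where
    "(f has_derivative (\<lambda>v. \<Sum>i\<in>UNIV. c i * v $ i)) (at s)"
    "(g has_derivative (\<lambda>v. \<Sum>i\<in>UNIV. d i * v $ i)) (at s)"
    unfolding hol_on_def by blast
  from has_derivative_add[OF this]
  have "((\<lambda>s. f s + g s) has_derivative (\<lambda>v. \<Sum>i\<in>UNIV. (c i + d i) * v $ i)) (at s)"
    by (simp add: sum.distrib distrib_right)
  then show "\<exists>c. ((\<lambda>s. f s + g s) has_derivative (\<lambda>v. \<Sum>i\<in>UNIV. c i * v $ i)) (at s)"
    by (intro exI[of _ "\<lambda>i. c i + d i"])
qed

lemma hol_on_mult:
  assumes "hol_on U f" "hol_on U g"
  shows "hol_on U (\<lambda>s. f s * g s)"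
  unfolding hol_on_def
proof
  fix s assume "s \<in> U"
  with assms obtain c d where
    "(f has_derivative (\<lambda>v. \<Sum>i\<in>UNIV. c i * v $ i)) (at s)"
    "(g has_derivative (\<lambda>v. \<Sum>i\<in>UNIV. d i * v $ i)) (at s)"
    unfolding hol_on_def by blast
  from has_derivative_mult[OF this]
  have "((\<lambda>s. f s * g s) has_derivative (\<lambda>v. \<Sum>i\<in>UNIV. (f s * d i + c i * g s) * v $ i)) (at s)"
    by (simp add: sum.distrib distrib_right sum_distrib_left sum_distrib_right mult.assoc
        mult.left_commute mult.commute[of _ "g s"])
  then show "\<exists>c. ((\<lambda>s. f s * g s) has_derivative (\<lambda>v. \<Sum>i\<in>UNIV. c i * v $ i)) (at s)"
    by (intro exI[of _ "\<lambda>i. f s * d i + c i * g s"])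
qed

lemma hol_on_sum: "(\<And>k. k \<in> K \<Longrightarrow> hol_on U (f k)) \<Longrightarrow> hol_on U (\<lambda>s. \<Sum>k\<in>K. f k s)"
  by (induction K rule: infinite_finite_induct) (auto intro: hol_on_const hol_on_add)

lemma hol_on_compose:
  fixes \<rho> :: "complex ^ 'n \<Rightarrow> complex ^ 'n::finite"
  assumes "hol_on V f" "\<And>i. hol_on U (\<lambda>s. \<rho> s $ i)" "\<And>s. s \<in> U \<Longrightarrow> \<rho> s \<in> V"
  shows "hol_on U (\<lambda>s. f (\<rho> s))"
  unfolding hol_on_def
proof
  fix s assume s: "s \<in> U"
  from assms(2) s have "\<forall>i. \<exists>c. ((\<lambda>s. \<rho> s $ i) has_derivative (\<lambda>v. \<Sum>k\<in>UNIV. c k * v $ k)) (at s)"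
    unfolding hol_on_def by blast
  then obtain d where
    d: "\<And>i. ((\<lambda>s. \<rho> s $ i) has_derivative (\<lambda>v. \<Sum>k\<in>UNIV. d i k * v $ k)) (at s)"
    by metis
  have \<rho>: "(\<rho> has_derivative (\<lambda>v. \<chi> i. \<Sum>k\<in>UNIV. d i k * v $ k)) (at s)"
    by (subst has_derivative_componentwise_within)
       (auto simp: Basis_vec_def inner_axis intro!: has_derivative_inner_left d)
  from assms(1,3) s obtain c where
    "(f has_derivative (\<lambda>v. \<Sum>i\<in>UNIV. c i * v $ i)) (at (\<rho> s))"
    unfolding hol_on_def by blast
  from has_derivative_compose[OF \<rho> this]
  have "((\<lambda>s. f (\<rho> s)) has_derivative (\<lambda>v. \<Sum>i\<in>UNIV. c i * (\<Sum>k\<in>UNIV. d i k * v $ k))) (at s)"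
    by simp
  also have "(\<lambda>v. \<Sum>i\<in>UNIV. c i * (\<Sum>k\<in>UNIV. d i k * v $ k))
      = (\<lambda>v :: complex ^ 'n. \<Sum>k\<in>UNIV. (\<Sum>i\<in>UNIV. c i * d i k) * v $ k)"
  proof
    fix v :: "complex ^ 'n"
    show "(\<Sum>i\<in>UNIV. c i * (\<Sum>k\<in>UNIV. d i k * v $ k)) = (\<Sum>k\<in>UNIV. (\<Sum>i\<in>UNIV. c i * d i k) * v $ k)"
      unfolding sum_distrib_left sum_distrib_right
      by (subst sum.swap) (simp add: mult_ac)
  qed
  finally show "\<exists>c. ((\<lambda>s. f (\<rho> s)) has_derivative (\<lambda>v. \<Sum>i\<in>UNIV. c i * v $ i)) (at s)"
    by (intro exI[of _ "\<lambda>k. \<Sum>i\<in>UNIV. c i * d i k"])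
qed

lemma hol_on_isCont: "hol_on U f \<Longrightarrow> s \<in> U \<Longrightarrow> isCont f s"
  unfolding hol_on_def by (meson has_derivative_continuous)

text \<open>The components of the derivative are the partial derivatives in the sense of \<^const>\<open>germ_pd\<close>.\<close>

lemma has_derivative_imp_pd:
  fixes s :: "complex ^ 'n::finite"
  assumes "(f has_derivative (\<lambda>v. \<Sum>i\<in>UNIV. c i * v $ i)) (at s)"
  shows "deriv (\<lambda>z. f (s + axis k z)) 0 = c k"
proof -
  have "bounded_linear (\<lambda>z :: complex. axis k z :: complex ^ 'n)"
    by (rule linear_conv_bounded_linear[THEN iffD1], rule linearI)
       (auto simp: axis_def vec_eq_iff)
  then have "((\<lambda>z :: complex. s + axis k z) has_derivative (\<lambda>z. axis k z)) (at 0)"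
    by (auto intro!: derivative_eq_intros bounded_linear_imp_has_derivative)
  moreover have "(f has_derivative (\<lambda>v. \<Sum>i\<in>UNIV. c i * v $ i)) (at (s + axis k 0))"
    using assms by (simp add: axis_def zero_vec_def[symmetric])
  ultimately have "((\<lambda>z. f (s + axis k z)) has_derivative
      (\<lambda>z. \<Sum>i\<in>UNIV. c i * (axis k z :: complex ^ 'n) $ i)) (at 0)"
    by (rule has_derivative_compose)
  moreover have "(\<Sum>i\<in>UNIV. c i * (axis k z :: complex ^ 'n) $ i) = c k * z" for z
    by (simp add: axis_def if_distrib[of "(*) _"] cong: if_cong)
  ultimately show ?thesis
    by (intro DERIV_imp_deriv) (simp add: has_field_derivative_def)
qed

definition const_germ :: "complex \<Rightarrow> 'n::finite germ" where
  "const_germ c = to_germ (\<lambda>_. c)"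

lemma const_germ_add: "const_germ (x + y) = const_germ x + const_germ y"
  by (simp add: const_germ_def plus_germ.abs_eq)

lemma const_germ_mult: "const_germ (x * y) = const_germ x * const_germ y"
  by (simp add: const_germ_def times_germ.abs_eq)

lemma const_germ_0 [simp]: "const_germ 0 = 0"
  by (simp add: const_germ_def zero_germ_def)

lemma const_germ_1 [simp]: "const_germ 1 = 1"
  by (simp add: const_germ_def one_germ_def)

lemma of_int_germ: "of_int k = const_germ (of_int k)"
proof -
  have nat: "of_nat m = const_germ (of_nat m)" for m
    by (induction m) (simp_all add: const_germ_add)
  show ?thesis
  proof (cases "k \<ge> 0")
    case True
    then show ?thesis using nat[of "nat k"] by simp
  next
    case False
    have "const_germ (- of_nat m) + const_germ (of_nat m) = (0 :: 'a germ)" for m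
      by (simp flip: const_germ_add)
    then have "const_germ (- of_nat m) = - (of_nat m :: 'a germ)" for m
      by (simp add: nat eq_neg_iff_add_eq_0)
    from this[of "nat (- k)"] False show ?thesis by simp
  qed
qed

text \<open>Germs have zero divisors when arbitrary functions are admitted, so cancelling an integer
  has to go through the inverse constant.\<close>

lemma of_int_mult_germ_eq_0:
  assumes "of_int k * (g :: 'n::finite germ) = 0" "k \<noteq> 0"
  shows "g = 0"
proof -
  have "const_germ (1 / of_int k) * (of_int k * g) = g"
    using assms(2) unfolding of_int_germ
    by (simp add: mult.assoc[symmetric] const_germ_mult[symmetric])
  with assms(1) show ?thesis by simp
qed

lemma hol_germsI: "open U \<Longrightarrow> 0 \<in> U \<Longrightarrow> hol_on U f \<Longrightarrow> to_germ f \<in> hol_germs"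
  unfolding hol_germs_def by blast

lemma hol_germsE:
  assumes "g \<in> hol_germs"
  obtains f U where "g = to_germ f" "open U" "0 \<in> U" "hol_on U f"
  using assms unfolding hol_germs_def by blast

lemma hol_germs_const [simp]: "const_germ c \<in> hol_germs"
  unfolding const_germ_def by (rule hol_germsI[of UNIV]) (auto intro: hol_on_const)

lemma hol_germs_0 [simp]: "0 \<in> hol_germs"
  using hol_germs_const[of 0] by simp

lemma hol_germs_1 [simp]: "1 \<in> hol_germs"
  using hol_germs_const[of 1] by simp

lemma hol_germs_coord [simp]: "coord j \<in> hol_germs"
  unfolding coord_def by (rule hol_germsI[of UNIV]) (auto intro: hol_on_component)

lemma has_derivative_series:
  fixes s :: "complex ^ 'n::finite"
  assumes "norm (s $ j) < fps_conv_radius h"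
  shows "((\<lambda>s. eval_fps h (s $ j)) has_derivative
    (\<lambda>v. \<Sum>i\<in>UNIV. (if i = j then eval_fps (fps_deriv h) (s $ j) else 0) * v $ i)) (at s)"
proof -
  have "((\<lambda>s :: complex ^ 'n. s $ j) has_derivative (\<lambda>v. v $ j)) (at s)"
    by (rule bounded_linear_imp_has_derivative) (rule bounded_linear_vec_nth)
  from has_derivative_compose[OF this
      has_field_derivative_eval_fps[OF assms, unfolded has_field_derivative_def]]
  show ?thesis
    by (simp add: if_distrib[of "\<lambda>x. x * _"] cong: if_cong)
qed

lemma open_series_domain:
  "open {s :: complex ^ 'n::finite. ereal (norm (s $ j)) < R}"
proof -
  have "continuous_on UNIV (\<lambda>s :: complex ^ 'n. ereal (norm (s $ j)))"
    by (intro continuous_intros)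
  then show ?thesis
    by (intro open_Collect_less continuous_intros)
qed

lemma hol_germs_series:
  assumes "fps_conv_radius h > 0"
  shows "series_germ h \<in> hol_germs"
  unfolding series_germ_def
proof (rule hol_germsI)
  show "open {s :: complex ^ 'n. ereal (norm (s $ idx 1)) < fps_conv_radius h}"
    by (rule open_series_domain)
  show "hol_on {s :: complex ^ 'n. ereal (norm (s $ idx 1)) < fps_conv_radius h}
      (\<lambda>s. eval_fps h (s $ idx 1))"
    unfolding hol_on_def by (auto intro!: exI has_derivative_series)
qed (use assms in \<open>simp add: zero_ereal_def\<close>)

lemma hol_germs_pullback:
  assumes "germ_biholomorphism \<rho>" "g \<in> hol_germs"
  shows "germ_pullback \<rho> g \<in> hol_germs"
proof -
  from assms(1) obtain U V \<sigma> where U: "\<rho> 0 = 0" "open U" "0 \<in> U" "homeomorphism U V \<rho> \<sigma>"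
    "\<And>i. hol_on U (\<lambda>s. \<rho> s $ i)"
    unfolding germ_biholomorphism_def by blast
  from assms(2) obtain f W where f: "g = to_germ f" "open W" "0 \<in> W" "hol_on W f"
    by (rule hol_germsE)
  have cont: "continuous_on U \<rho>"
    using U(4) by (simp add: homeomorphism_def)
  then have "open (U \<inter> \<rho> -` W)"
    using U(2) f(2) by (simp add: continuous_on_open_vimage Int_commute)
  moreover have "hol_on (U \<inter> \<rho> -` W) (\<lambda>s. f (\<rho> s))"
    by (rule hol_on_compose[OF f(4)]) (auto intro: hol_on_subset[OF U(5)])
  ultimately have "to_germ (\<lambda>s. f (\<rho> s)) \<in> hol_germs"
    using U(1,3) f(3) by (intro hol_germsI[of "U \<inter> \<rho> -` W"]) auto
  then show ?thesis
    unfolding f(1) germ_pullback.abs_eq by (auto simp flip: zero_germ_def)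
qed

section \<open>Values, pullbacks and partial derivatives of germs\<close>

lift_definition germ_value :: "'n::finite germ \<Rightarrow> complex" is "\<lambda>f. f 0"
  by (auto dest: eventually_nhds_x_imp_x)

lemma germ_value_add [simp]: "germ_value (x + y) = germ_value x + germ_value y"
  by transfer simp

lemma germ_value_mult [simp]: "germ_value (x * y) = germ_value x * germ_value y"
  by transfer simp

lemma germ_value_0 [simp]: "germ_value 0 = 0"
  by transfer simp

lemma germ_value_1 [simp]: "germ_value 1 = 1"
  by transfer simp

lemma germ_value_const [simp]: "germ_value (const_germ c) = c"
  unfolding const_germ_def by transfer simp

lemma germ_value_coord [simp]: "germ_value (coord j) = 0"
  unfolding coord_def by transfer simp

lemma germ_value_series [simp]: "germ_value (series_germ h) = fps_nth h 0"
  unfolding series_germ_def by transfer (simp add: eval_fps_at_0)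

lemma germ_value_sum: "germ_value (\<Sum>k\<in>K. f k) = (\<Sum>k\<in>K. germ_value (f k))"
  by (induction K rule: infinite_finite_induct) simp_all

lemma germ_pullback_add: "germ_pullback \<rho> (x + y) = germ_pullback \<rho> x + germ_pullback \<rho> y"
  by transfer simp

lemma germ_pullback_mult: "germ_pullback \<rho> (x * y) = germ_pullback \<rho> x * germ_pullback \<rho> y"
  by transfer simp

lemma germ_pullback_sum: "germ_pullback \<rho> (\<Sum>k\<in>K. f k) = (\<Sum>k\<in>K. germ_pullback \<rho> (f k))"
  by (induction K rule: infinite_finite_induct) (simp_all add: germ_pullback_add)

lemma biholomorphism_tendsto:
  assumes "germ_biholomorphism \<rho>"
  shows "filterlim \<rho> (nhds 0) (nhds 0)"
proof -
  from assms obtain U V \<sigma> where U: "\<rho> 0 = 0" "open U" "0 \<in> U" "homeomorphism U V \<rho> \<sigma>"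
    unfolding germ_biholomorphism_def by blast
  then have "isCont \<rho> 0"
    by (auto simp: homeomorphism_def continuous_on_eq_continuous_at)
  then show ?thesis
    using U(1) tendsto_at_iff_tendsto_nhds[of \<rho> 0] by (simp add: isCont_def)
qed

lemma germ_pullback_1:
  assumes "germ_biholomorphism \<rho>"
  shows "germ_pullback \<rho> 1 = 1"
  using biholomorphism_tendsto[OF assms] by transfer simp

lemma germ_value_pullback:
  assumes "germ_biholomorphism \<rho>"
  shows "germ_value (germ_pullback \<rho> g) = germ_value g"
proof -
  have "\<rho> 0 = 0" using assms by (simp add: germ_biholomorphism_def)
  then show ?thesis
    using biholomorphism_tendsto[OF assms] by transfer simp
qed

lemma germ_pd_1 [simp]: "germ_pd i 1 = 0"
  by transfer simp

lemma idx_eq_iff: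
  "i \<in> {1..CARD('n)} \<Longrightarrow> j \<in> {1..CARD('n)} \<Longrightarrow> idx i = (idx j :: 'n::finite) \<longleftrightarrow> i = j"
  using bij_betw_idx[where 'n = 'n] by (intro inj_on_eq_iff) (auto simp: bij_betw_def)

lemma germ_pd_coord:
  assumes "i \<in> {1..CARD('n)}" "j \<in> {1..CARD('n)}"
  shows "germ_pd i (coord j :: 'n::finite germ) = (if i = j then 1 else 0)"
proof -
  have "deriv (\<lambda>z. (s + axis (idx i) z) $ idx j) 0 = (if i = j then 1 else 0)" for s :: "complex ^ 'n"
    using has_derivative_imp_pd[OF has_derivative_component, of s "idx i" "idx j"] idx_eq_iff[OF assms]
    by (simp only: split: if_splits)
  then show ?thesis
    unfolding coord_def germ_pd.abs_eq one_germ_def zero_germ_def by simp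
qed

lemma germ_pd_series:
  assumes "i \<in> {1..CARD('n)}" "fps_conv_radius h > 0"
  shows "germ_pd i (series_germ h :: 'n::finite germ) = (if i = 1 then series_germ (fps_deriv h) else 0)"
proof -
  have inj: "idx i = (idx 1 :: 'n) \<longleftrightarrow> i = 1"
    using idx_eq_iff[OF assms(1), of 1] by simp
  have "\<forall>\<^sub>F s :: complex ^ 'n in nhds 0. s \<in> {s. ereal (norm (s $ idx 1)) < fps_conv_radius h}"
    by (rule eventually_nhds_in_open[OF open_series_domain])
       (use assms(2) in \<open>simp add: zero_ereal_def\<close>)
  then have "\<forall>\<^sub>F s :: complex ^ 'n in nhds 0.
      deriv (\<lambda>z. eval_fps h ((s + axis (idx i) z) $ idx 1)) 0
        = (if i = 1 then eval_fps (fps_deriv h) (s $ idx 1) else 0)"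
  proof (rule eventually_mono)
    fix s :: "complex ^ 'n"
    assume "s \<in> {s. ereal (norm (s $ idx 1)) < fps_conv_radius h}"
    then show "deriv (\<lambda>z. eval_fps h ((s + axis (idx i) z) $ idx 1)) 0
        = (if i = 1 then eval_fps (fps_deriv h) (s $ idx 1) else 0)"
      using has_derivative_imp_pd[OF has_derivative_series[of s "idx 1" h], of "idx i"] inj by simp
  qed
  then show ?thesis
    unfolding series_germ_def germ_pd.abs_eq zero_germ_def
    by (auto simp: germ.abs_eq_iff)
qed

text \<open>On a ball around \<open>0\<close> on which all partial derivatives vanish the whole derivative does,
  since \<^const>\<open>idx\<close> exhausts the coordinates.\<close>

lemma hol_germ_constI:
  fixes g :: "'n::finite germ"
  assumes "g \<in> hol_germs" "\<And>i. i \<in> {1..CARD('n)} \<Longrightarrow> germ_pd i g = 0"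
  shows "\<exists>c. g = const_germ c"
proof -
  from assms(1) obtain f U where f: "g = to_germ f" "open U" "0 \<in> U" "hol_on U f"
    by (rule hol_germsE)
  have "\<forall>i\<in>{1..CARD('n)}. \<forall>\<^sub>F s in nhds 0. deriv (\<lambda>z. f (s + axis (idx i) z)) 0 = 0"
    using assms(2) by (auto simp: f(1) germ_pd.abs_eq zero_germ_def germ.abs_eq_iff)
  then have "\<forall>\<^sub>F s in nhds 0. \<forall>i\<in>{1..CARD('n)}. deriv (\<lambda>z. f (s + axis (idx i) z)) 0 = 0"
    by (simp add: eventually_ball_finite)
  moreover have "\<forall>\<^sub>F s in nhds 0. s \<in> U"
    using f(2,3) by (rule eventually_nhds_in_open)
  ultimately have
    "\<forall>\<^sub>F s in nhds 0. s \<in> U \<and> (\<forall>i\<in>{1..CARD('n)}. deriv (\<lambda>z. f (s + axis (idx i) z)) 0 = 0)"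
    by (simp add: eventually_conj)
  then obtain e where e: "e > 0" "\<And>s. s \<in> ball 0 e \<Longrightarrow>
      s \<in> U \<and> (\<forall>i\<in>{1..CARD('n)}. deriv (\<lambda>z. f (s + axis (idx i) z)) 0 = 0)"
    unfolding eventually_nhds_metric by (auto simp: dist_commute)
  have "(f has_derivative (\<lambda>_. 0)) (at s within ball 0 e)" if s: "s \<in> ball 0 e" for s
  proof -
    from e(2)[OF s] f(4) obtain c where
      c: "(f has_derivative (\<lambda>v. \<Sum>i\<in>UNIV. c i * v $ i)) (at s)"
      unfolding hol_on_def by blast
    have "c k = 0" for k
    proof -
      obtain i where i: "i \<in> {1..CARD('n)}" "k = idx i"
        using bij_betw_idx[where 'n = 'n] unfolding bij_betw_def by blast
      have "deriv (\<lambda>z. f (s + axis (idx i) z)) 0 = c k"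
        using has_derivative_imp_pd[OF c, of k] i(2) by simp
      with e(2)[OF s] i(1) show ?thesis by simp
    qed
    with c show ?thesis
      by (simp add: has_derivative_at_withinI)
  qed
  then obtain d where "\<forall>s\<in>ball 0 e. f s = d"
    using has_derivative_zero_constant[of "ball 0 e" f] by auto
  then have "\<forall>\<^sub>F s in nhds 0. f s = d"
    using e(1) eventually_nhds_in_open[of "ball 0 e" 0]
    by (auto elim: eventually_mono)
  then show ?thesis
    unfolding f(1) const_germ_def germ.abs_eq_iff by blast
qed

section \<open>The rings of convergent series\<close>

text \<open>Pulling back coefficients may raise the subdegree of a series. Convolution over a range given
  by any lower bounds for the supports allows one range to serve a series and its pullback.\<close>

lemma fls_times_nth_bounds:
  fixes a b :: "'a::comm_ring_1 fls"
  assumes "\<forall>i<k. fls_nth a i = 0" "\<forall>i<m. fls_nth b i = 0"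
  shows "fls_nth (a * b) n = (\<Sum>i=k..n-m. fls_nth a i * fls_nth b (n - i))"
proof (cases "a = 0 \<or> b = 0")
  case False
  then have "k \<le> fls_subdegree a" "m \<le> fls_subdegree b"
    using assms by (auto intro: fls_subdegree_geI)
  then have "(\<Sum>i=fls_subdegree a..n - fls_subdegree b. fls_nth a i * fls_nth b (n - i))
      = (\<Sum>i=k..n-m. fls_nth a i * fls_nth b (n - i))"
    by (intro sum.mono_neutral_left) auto
  then show ?thesis by (simp add: fls_times_nth(2))
qed auto

lemma fls_times_nth_nonneg:
  fixes a b :: "'a::comm_ring_1 fls"
  assumes "\<forall>i<0. fls_nth a i = 0" "\<forall>i<0. fls_nth b i = 0"
  shows "fls_nth (a * b) (int k) = (\<Sum>i\<le>k. fls_nth a (int i) * fls_nth b (int (k - i)))"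
    and "n < 0 \<Longrightarrow> fls_nth (a * b) n = 0"
proof -
  have "fls_nth (a * b) (int k) = (\<Sum>i\<in>int ` {..k}. fls_nth a i * fls_nth b (int k - i))"
    using fls_times_nth_bounds[OF assms, of "int k"] by (simp add: atMost_atLeast0 image_int_atLeastAtMost)
  then show "fls_nth (a * b) (int k) = (\<Sum>i\<le>k. fls_nth a (int i) * fls_nth b (int (k - i)))"
    by (simp add: sum.reindex of_nat_diff)
  show "n < 0 \<Longrightarrow> fls_nth (a * b) n = 0"
    using fls_times_nth_bounds[OF assms, of n] by simp
qed

lemma to_germ_sum: "(\<Sum>k\<in>K. to_germ (f k)) = to_germ (\<lambda>s. \<Sum>k\<in>K. f k s)"
  by (induction K rule: infinite_finite_induct) (simp_all add: plus_germ.abs_eq zero_germ_def)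

text \<open>Weierstrass' test on the ball of radius \<open>1 / (2 C)\<close>, where the terms are at most \<open>M / 2\<^sup>k\<close>.\<close>

lemma conv_seriesI:
  assumes "\<forall>n<0. fls_nth a n = 0" "open U" "0 \<in> U" "C > 0"
    and "\<And>k. hol_on U (g k)" "\<And>k. fls_nth a (int k) = to_germ (g k)"
    and bound: "\<And>k s. s \<in> U \<Longrightarrow> norm (g k s) \<le> M * C ^ k * fact k"
  shows "a \<in> conv_series"
proof -
  have "uniform_limit (U \<times> ball 0 (1 / (2 * C)))
      (\<lambda>N z. \<Sum>k<N. g k (fst z) * snd z ^ k / fact k)
      (\<lambda>z. \<Sum>k. g k (fst z) * snd z ^ k / fact k) sequentially"
  proof (rule Weierstrass_m_test)
    fix k and z :: "(complex ^ 'a) \<times> complex"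
    assume z: "z \<in> U \<times> ball 0 (1 / (2 * C))"
    have M: "M * C ^ k * fact k \<ge> 0"
      using bound[of "fst z" k] z by (auto intro: order_trans[OF norm_ge_zero])
    have "norm (g k (fst z) * snd z ^ k / fact k) = norm (g k (fst z)) * norm (snd z) ^ k / fact k"
      by (simp add: norm_mult norm_divide norm_power)
    also have "\<dots> \<le> (M * C ^ k * fact k) * (1 / (2 * C)) ^ k / fact k"
      using z bound[of "fst z" k] M
      by (intro divide_right_mono mult_mono power_mono) auto
    also have "\<dots> = M * (1 / 2) ^ k"
      using assms(4) by (simp add: power_divide power_mult_distrib)
    finally show "norm (g k (fst z) * snd z ^ k / fact k) \<le> M * (1 / 2) ^ k" .
  next
    show "summable (\<lambda>k. M * (1 / 2 :: real) ^ k)"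
      by (intro summable_mult summable_geometric) simp
  qed
  then have "uniformly_convergent_on (U \<times> ball 0 (1 / (2 * C)))
      (\<lambda>N (s, x). \<Sum>k<N. g k s * x ^ k / fact k)"
    by (auto simp: uniformly_convergent_on_def case_prod_beta')
  moreover have "1 / (2 * C) > 0"
    using assms(4) by simp
  ultimately show ?thesis
    unfolding conv_series_def using assms(1-3,5,6) by blast
qed

text \<open>The converse of the previous estimate. Uniform convergence makes all but finitely many terms
  smaller than \<open>1\<close>, and the remaining ones are bounded near \<open>0\<close> by continuity. Together they
  replace uniform convergence on a product domain by an estimate that is visibly stable under
  sums and Cauchy products.\<close>

lemma conv_seriesE:
  assumes "a \<in> conv_series"
  obtains U C M g where "\<forall>n<0. fls_nth a n = 0" "open U" "0 \<in> U" "C > 0" "M \<ge> 0"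
    "\<And>k. hol_on U (g k)" "\<And>k. fls_nth a (int k) = to_germ (g k)"
    "\<And>k s. s \<in> U \<Longrightarrow> norm (g k s) \<le> M * C ^ k * fact k"
proof -
  from assms obtain U \<epsilon> g where neg: "\<forall>n<0. fls_nth a n = 0"
    and U: "open U" "0 \<in> U" "\<epsilon> > 0"
    and g: "\<And>k. hol_on U (g k)" "\<And>k. fls_nth a (int k) = to_germ (g k)"
    and conv: "uniformly_convergent_on (U \<times> ball 0 \<epsilon>)
      (\<lambda>N (s, x :: complex). \<Sum>k<N. g k s * x ^ k / fact k)"
    unfolding conv_series_def by blast
  define S where "S = (\<lambda>N (s, x :: complex). \<Sum>k<N. g k s * x ^ k / fact k)"
  from conv obtain K where K: "\<And>z m n. z \<in> U \<times> ball 0 \<epsilon> \<Longrightarrow> m \<ge> K \<Longrightarrow> n \<ge> K \<Longrightarrow> dist (S m z) (S n z) < 1"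
    unfolding S_def[symmetric] uniformly_convergent_eq_Cauchy uniformly_Cauchy_on_def
    by (meson zero_less_one)
  define M where "M = 1 + (\<Sum>k<K. norm (g k 0) + 1) * (1 + \<epsilon> / 2) ^ K"
  have "\<forall>k<K. \<forall>\<^sub>F s in nhds 0. norm (g k s) < norm (g k 0) + 1"
  proof (intro allI impI)
    fix k
    have "isCont (\<lambda>s. norm (g k s)) 0"
      using hol_on_isCont[OF g(1) U(2)] by (intro continuous_intros)
    then have "filterlim (\<lambda>s. norm (g k s)) (nhds (norm (g k 0))) (nhds 0)"
      using tendsto_at_iff_tendsto_nhds[of "\<lambda>s. norm (g k s)" 0] by (simp add: isCont_def)
    then show "\<forall>\<^sub>F s in nhds 0. norm (g k s) < norm (g k 0) + 1"
      by (rule order_tendstoD) simp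
  qed
  then have "\<forall>\<^sub>F s in nhds 0. \<forall>k\<in>{..<K}. norm (g k s) < norm (g k 0) + 1"
    by (simp add: eventually_ball_finite)
  then obtain V where V: "open V" "0 \<in> V"
      "\<And>s k. s \<in> V \<Longrightarrow> k < K \<Longrightarrow> norm (g k s) < norm (g k 0) + 1"
    unfolding eventually_nhds by auto
  have M: "M \<ge> 1"
    unfolding M_def using U(3) by (auto intro!: mult_nonneg_nonneg sum_nonneg)
  have le: "norm (g k s) * (\<epsilon> / 2) ^ k \<le> M * fact k" if s: "s \<in> U \<inter> V" for k s
  proof (cases "k < K")
    case True
    have "(\<epsilon> / 2) ^ k \<le> (1 + \<epsilon> / 2) ^ k"
      using U(3) by (intro power_mono) auto
    also have "\<dots> \<le> (1 + \<epsilon> / 2) ^ K"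
      using True U(3) by (intro power_increasing) auto
    finally have "norm (g k s) * (\<epsilon> / 2) ^ k \<le> (norm (g k 0) + 1) * (1 + \<epsilon> / 2) ^ K"
      using V(3)[of s k] s True U(3) by (intro mult_mono) auto
    also have "\<dots> \<le> (\<Sum>k<K. norm (g k 0) + 1) * (1 + \<epsilon> / 2) ^ K"
      using True U(3) by (intro mult_right_mono member_le_sum) auto
    also have "\<dots> \<le> M * 1"
      unfolding M_def by simp
    also have "\<dots> \<le> M * fact k"
      using M by (intro mult_left_mono) (auto simp: fact_ge_1)
    finally show ?thesis .
  next
    case False
    have "dist (S (Suc k) (s, of_real (\<epsilon> / 2))) (S k (s, of_real (\<epsilon> / 2))) < 1"
      using False s U(3) by (intro K) auto
    then have "norm (g k s) * (\<epsilon> / 2) ^ k < fact k"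
      using U(3) by (simp add: S_def dist_norm norm_mult norm_divide norm_power divide_simps mult.commute)
    also have "\<dots> \<le> M * fact k"
      using M by simp
    finally show ?thesis by simp
  qed
  show ?thesis
  proof (rule that[of "U \<inter> V" "2 / \<epsilon>" M g])
    fix k s assume "s \<in> U \<inter> V"
    from le[OF this] have "norm (g k s) \<le> M * fact k / (\<epsilon> / 2) ^ k"
      using U(3) by (simp add: pos_le_divide_eq)
    also have "\<dots> = M * (2 / \<epsilon>) ^ k * fact k"
      by (simp add: power_divide divide_simps)
    finally show "norm (g k s) \<le> M * (2 / \<epsilon>) ^ k * fact k" .
  next
    show "hol_on (U \<inter> V) (g k)" for k
      by (rule hol_on_subset[OF g(1)]) simp
  qed (use neg U V M g in auto)
qed

lemma conv_series_add:
  assumes "a \<in> conv_series" "b \<in> conv_series"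
  shows "a + b \<in> conv_series"
proof -
  from assms(1) obtain U C M g where a: "\<forall>n<0. fls_nth a n = 0" "open U" "0 \<in> U" "C > 0" "M \<ge> 0"
    "\<And>k. hol_on U (g k)" "\<And>k. fls_nth a (int k) = to_germ (g k)"
    "\<And>k s. s \<in> U \<Longrightarrow> norm (g k s) \<le> M * C ^ k * fact k" by (rule conv_seriesE) blast
  from assms(2) obtain V D N f where b: "\<forall>n<0. fls_nth b n = 0" "open V" "0 \<in> V" "D > 0" "N \<ge> 0"
    "\<And>k. hol_on V (f k)" "\<And>k. fls_nth b (int k) = to_germ (f k)"
    "\<And>k s. s \<in> V \<Longrightarrow> norm (f k s) \<le> N * D ^ k * fact k" by (rule conv_seriesE) blast
  show ?thesis
  proof (rule conv_seriesI[where U = "U \<inter> V" and C = "max C D" and M = "M + N" and g = "\<lambda>k s. g k s + f k s"])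
    fix k s assume s: "s \<in> U \<inter> V"
    have "norm (g k s + f k s) \<le> M * C ^ k * fact k + N * D ^ k * fact k"
      using a(8)[of s k] b(8)[of s k] s by (intro norm_triangle_le add_mono) auto
    also have "\<dots> \<le> M * max C D ^ k * fact k + N * max C D ^ k * fact k"
      using a(4,5) b(4,5) by (intro add_mono mult_right_mono mult_left_mono power_mono) auto
    finally show "norm (g k s + f k s) \<le> (M + N) * max C D ^ k * fact k"
      by (simp add: algebra_simps)
  next
    show "hol_on (U \<inter> V) (\<lambda>s. g k s + f k s)" for k
      using a(6) b(6) by (intro hol_on_add) (blast intro: hol_on_subset)+
  qed (use a b in \<open>auto simp: plus_germ.abs_eq\<close>)
qed

text \<open>The factorials in the definition are harmless here because \<open>i! (k - i)! \<le> k!\<close>; the number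
  \<open>k + 1 \<le> 2\<^sup>k\<close> of summands is absorbed into the radius.\<close>

lemma conv_series_mult:
  assumes "a \<in> conv_series" "b \<in> conv_series"
  shows "a * b \<in> conv_series"
proof -
  from assms(1) obtain U C M g where a: "\<forall>n<0. fls_nth a n = 0" "open U" "0 \<in> U" "C > 0" "M \<ge> 0"
    "\<And>k. hol_on U (g k)" "\<And>k. fls_nth a (int k) = to_germ (g k)"
    "\<And>k s. s \<in> U \<Longrightarrow> norm (g k s) \<le> M * C ^ k * fact k" by (rule conv_seriesE) blast
  from assms(2) obtain V D N f where b: "\<forall>n<0. fls_nth b n = 0" "open V" "0 \<in> V" "D > 0" "N \<ge> 0"
    "\<And>k. hol_on V (f k)" "\<And>k. fls_nth b (int k) = to_germ (f k)"
    "\<And>k s. s \<in> V \<Longrightarrow> norm (f k s) \<le> N * D ^ k * fact k" by (rule conv_seriesE) blast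
  define E where "E = max C D"
  have E: "E > 0" "C \<le> E" "D \<le> E"
    using a(4) by (auto simp: E_def)
  show ?thesis
  proof (rule conv_seriesI[where U = "U \<inter> V" and C = "2 * E" and M = "M * N"
        and g = "\<lambda>k s. \<Sum>i\<le>k. g i s * f (k - i) s"])
    fix k s assume s: "s \<in> U \<inter> V"
    have "norm (g i s * f (k - i) s) \<le> M * N * E ^ k * fact k" if "i \<le> k" for i
    proof -
      have "norm (g i s * f (k - i) s) \<le> (M * C ^ i * fact i) * (N * D ^ (k - i) * fact (k - i))"
        unfolding norm_mult using s a(4,5,8) by (intro mult_mono a b) auto
      also have "\<dots> \<le> (M * E ^ i * fact i) * (N * E ^ (k - i) * fact (k - i))"
        using E a(4,5) b(4,5) by (intro mult_mono mult_right_mono mult_left_mono power_mono) auto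
      also have "\<dots> = M * N * (E ^ i * E ^ (k - i)) * (fact i * fact (k - i))"
        by simp
      also have "E ^ i * E ^ (k - i) = E ^ k"
        using that by (simp flip: power_add)
      also have "M * N * E ^ k * (fact i * fact (k - i)) \<le> M * N * E ^ k * fact k"
      proof (rule mult_left_mono)
        have "fact i * fact (k - i) \<le> (fact k :: nat)"
          using fact_fact_dvd_fact[of i "k - i", where 'a = nat] that by (intro dvd_imp_le) simp_all
        then show "fact i * fact (k - i) \<le> (fact k :: real)"
          by (metis of_nat_fact of_nat_le_iff of_nat_mult)
      qed (use E a(5) b(5) in auto)
      finally show ?thesis .
    qed
    then have "norm (\<Sum>i\<le>k. g i s * f (k - i) s) \<le> of_nat (card {..k}) * (M * N * E ^ k * fact k)"
      by (intro sum_norm_bound) auto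
    also have "\<dots> \<le> 2 ^ k * (M * N * E ^ k * fact k)"
    proof (rule mult_right_mono)
      have "Suc k \<le> 2 ^ k"
        by (simp add: Suc_le_eq)
      then show "real (card {..k}) \<le> 2 ^ k"
        by (metis card_atMost of_nat_le_iff of_nat_numeral of_nat_power)
    qed (use E a(5) b(5) in auto)
    finally show "norm (\<Sum>i\<le>k. g i s * f (k - i) s) \<le> M * N * (2 * E) ^ k * fact k"
      by (simp add: power_mult_distrib mult_ac)
  next
    fix k
    show "hol_on (U \<inter> V) (\<lambda>s. \<Sum>i\<le>k. g i s * f (k - i) s)"
      using a(6) b(6) by (intro hol_on_sum hol_on_mult) (auto intro: hol_on_subset)
    show "fls_nth (a * b) (int k) = to_germ (\<lambda>s. \<Sum>i\<le>k. g i s * f (k - i) s)"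
      unfolding fls_times_nth_nonneg(1)[OF a(1) b(1)] a(7) b(7) times_germ.abs_eq to_germ_sum ..
  qed (use a b E fls_times_nth_nonneg(2)[OF a(1) b(1)] in auto)
qed

lemma conv_series_monomial:
  assumes "g \<in> hol_germs"
  shows "fls_const g * fls_X ^ m \<in> conv_series"
proof -
  from assms obtain f U where f: "g = to_germ f" "open U" "0 \<in> U" "hol_on U f"
    by (rule hol_germsE)
  have "isCont (\<lambda>s. norm (f s)) 0"
    using hol_on_isCont[OF f(4,3)] by (intro continuous_intros)
  then have "filterlim (\<lambda>s. norm (f s)) (nhds (norm (f 0))) (nhds 0)"
    using tendsto_at_iff_tendsto_nhds[of "\<lambda>s. norm (f s)" 0] by (simp add: isCont_def)
  then have "\<forall>\<^sub>F s in nhds 0. norm (f s) < norm (f 0) + 1"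
    by (rule order_tendstoD) simp
  then obtain V where V: "open V" "0 \<in> V" "\<And>s. s \<in> V \<Longrightarrow> norm (f s) < norm (f 0) + 1"
    unfolding eventually_nhds by auto
  show ?thesis
  proof (rule conv_seriesI[where U = "U \<inter> V" and C = 1 and M = "norm (f 0) + 1"
        and g = "\<lambda>k. if k = m then f else (\<lambda>_. 0)"])
    fix k s assume "s \<in> U \<inter> V"
    then have "norm (f s) \<le> (norm (f 0) + 1) * 1"
      using V(3)[of s] by simp
    also have "\<dots> \<le> (norm (f 0) + 1) * fact k"
      by (intro mult_left_mono) (auto simp: fact_ge_1)
    finally show "norm ((if k = m then f else (\<lambda>_. 0)) s) \<le> (norm (f 0) + 1) * 1 ^ k * fact k"
      by auto
  qed (use f V in \<open>auto intro: hol_on_subset hol_on_const simp flip: zero_germ_def\<close>)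
qed

lemma conv_series_1: "1 \<in> conv_series"
  using conv_series_monomial[of 1 0] by simp

lemma conv_series_X_power: "fls_X ^ m \<in> conv_series"
  using conv_series_monomial[of 1 m] by simp

lemma conv_laurent_add:
  assumes "a \<in> conv_laurent" "b \<in> conv_laurent"
  shows "a + b \<in> conv_laurent"
proof -
  from assms obtain N M where "fls_X ^ N * a \<in> conv_series" "fls_X ^ M * b \<in> conv_series"
    unfolding conv_laurent_def by blast
  from conv_series_add[OF conv_series_mult[OF conv_series_X_power[of M] this(1)]
      conv_series_mult[OF conv_series_X_power[of N] this(2)]]
  have "fls_X ^ (N + M) * (a + b) \<in> conv_series"
    by (simp add: algebra_simps power_add)
  then show ?thesis unfolding conv_laurent_def by blast
qed

lemma conv_laurent_mult:
  assumes "a \<in> conv_laurent" "b \<in> conv_laurent"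
  shows "a * b \<in> conv_laurent"
proof -
  from assms obtain N M where "fls_X ^ N * a \<in> conv_series" "fls_X ^ M * b \<in> conv_series"
    unfolding conv_laurent_def by blast
  then have "(fls_X ^ N * a) * (fls_X ^ M * b) \<in> conv_series"
    by (rule conv_series_mult)
  then have "fls_X ^ (N + M) * (a * b) \<in> conv_series"
    by (simp add: algebra_simps power_add)
  then show ?thesis unfolding conv_laurent_def by blast
qed

lemma conv_series_subset_laurent: "a \<in> conv_series \<Longrightarrow> a \<in> conv_laurent"
  unfolding conv_laurent_def by (auto intro: exI[of _ 0])

lemma conv_laurent_const: "g \<in> hol_germs \<Longrightarrow> fls_const g \<in> conv_laurent"
  using conv_series_monomial[of g 0] by (simp add: conv_series_subset_laurent)

lemma conv_laurent_0: "0 \<in> conv_laurent"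
  using conv_laurent_const[of 0] by simp

lemma conv_laurent_1: "1 \<in> conv_laurent"
  using conv_laurent_const[of 1] by simp

lemma conv_laurent_Dt: "Dt k \<in> conv_laurent"
proof -
  have "fls_X ^ nat k * Dt k = (fls_X ^ nat (- k) :: 'a germ fls)"
    unfolding Dt_def fls_X_power_conv_shift_1 fls_X_intpow_times_fls_X_intpow by simp
  then show ?thesis
    unfolding conv_laurent_def using conv_series_X_power by (metis (mono_tags, lifting) mem_Collect_eq)
qed

lemma conv_laurent_sum: "(\<And>k. k \<in> K \<Longrightarrow> f k \<in> conv_laurent) \<Longrightarrow> (\<Sum>k\<in>K. f k) \<in> conv_laurent"
  by (induction K rule: infinite_finite_induct) (auto intro: conv_laurent_0 conv_laurent_add)

lemma fls_nth_Dt: "fls_nth (Dt k) n = (if n = - k then 1 else 0)"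
  by (simp add: Dt_def)

lemma conv_laurent_finite_support:
  assumes "\<And>n. fls_nth a n \<in> hol_germs" "finite {n. fls_nth a n \<noteq> 0}"
  shows "a \<in> conv_laurent"
proof -
  have "a = (\<Sum>k | fls_nth a k \<noteq> 0. fls_const (fls_nth a k) * Dt (- k))"
    by (rule fls_eqI) (simp add: fls_nth_sum fls_nth_Dt if_distrib assms(2) cong: if_cong)
  also have "\<dots> \<in> conv_laurent"
    by (intro conv_laurent_sum conv_laurent_mult conv_laurent_const conv_laurent_Dt assms(1))
  finally show ?thesis .
qed

lemma conv_series_nth_neg: "a \<in> conv_series \<Longrightarrow> n < 0 \<Longrightarrow> fls_nth a n = 0"
  unfolding conv_series_def by blast

lemma conv_laurent_nth_hol:
  assumes "a \<in> conv_laurent"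
  shows "fls_nth a n \<in> hol_germs"
proof -
  from assms obtain N where "fls_X ^ N * a \<in> conv_series"
    unfolding conv_laurent_def by blast
  then obtain U C M g where N: "\<forall>n<0. fls_nth (fls_X ^ N * a) n = 0" "open U" "0 \<in> U"
    "\<And>k. hol_on U (g k)" "\<And>k. fls_nth (fls_X ^ N * a) (int k) = to_germ (g k)"
    by (rule conv_seriesE) blast
  have "fls_nth (fls_X ^ N * a) (n + int N) \<in> hol_germs"
  proof (cases "n + int N < 0")
    case False
    then show ?thesis
      using N(5)[of "nat (n + int N)"] hol_germsI[OF N(2,3,4)] by simp
  qed (use N(1) in auto)
  then show ?thesis
    by (simp add: fls_X_power_times_conv_shift)
qed

section \<open>Sections of the Gauss--Manin system\<close>

lemma cst_eq: "cst z = fls_const (const_germ z)"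
  by (simp add: cst_def const_germ_def)

lemma cst_0 [simp]: "cst 0 = 0"
  by (simp add: cst_eq)

lemma cst_1 [simp]: "cst 1 = 1"
  by (simp add: cst_eq)

lemma cst_mult: "cst (x * y) = cst x * cst y"
  by (simp add: cst_eq const_germ_mult)

lemma cst_sum: "cst (\<Sum>j\<in>K. x j) = (\<Sum>j\<in>K. cst (x j))"
  by (induction K rule: infinite_finite_induct) (simp_all add: cst_eq const_germ_add flip: fls_plus_const)

lemma cst_eq_iff [simp]: "cst x = cst y \<longleftrightarrow> x = y"
proof
  assume "cst x = (cst y :: 'a germ fls)"
  then have "germ_value (fls_nth (cst x :: 'a germ fls) 0) = germ_value (fls_nth (cst y :: 'a germ fls) 0)"
    by simp
  then show "x = y" by (simp add: cst_eq)
qed simp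

lemma conv_laurent_cst: "cst z \<in> conv_laurent"
  by (simp add: cst_eq conv_laurent_const)

lemma GM_scale: "a \<in> conv_laurent \<Longrightarrow> u \<in> GM \<Longrightarrow> (\<lambda>l. a * u l) \<in> GM"
  by (auto simp: GM_def conv_laurent_mult)

lemma GM_sum: "(\<And>k. k \<in> K \<Longrightarrow> u k \<in> GM) \<Longrightarrow> (\<lambda>l. \<Sum>k\<in>K. u k l) \<in> GM"
  by (auto simp: GM_def intro!: conv_laurent_sum sum.neutral)

lemma GM_comb:
  fixes u :: "nat \<Rightarrow> 'n::finite vect"
  assumes "\<And>j. j \<le> CARD('n) \<Longrightarrow> c j \<in> conv_laurent" "\<And>j. j \<le> CARD('n) \<Longrightarrow> u j \<in> GM"
  shows "comb c u \<in> GM"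
  unfolding comb_def by (intro GM_sum GM_scale) (use assms in auto)

lemma GM_hframe: "j \<le> CARD('n) \<Longrightarrow> hframe j \<in> (GM :: 'n::finite vect set)"
  by (auto simp: GM_def hframe_def conv_laurent_0 conv_laurent_1)

lemma comb_hframe: "comb c (hframe :: nat \<Rightarrow> 'n::finite vect) = (\<lambda>l. if l \<le> CARD('n) then c l else 0)"
  by (rule ext) (simp add: comb_def hframe_def if_distrib cong: if_cong)

lemma comb_hframe_GM: "u \<in> GM \<Longrightarrow> comb u hframe = u"
  by (auto simp: comb_hframe GM_def)

lemma fls_nth_fls_map_pullback:
  "fls_nth (fls_map (germ_pullback \<rho>) a) n = germ_pullback \<rho> (fls_nth a n)"
  by (rule fls_nth_fls_map) simp

lemma fls_map_pullback_mult:
  "fls_map (germ_pullback \<rho>) (a * b) = fls_map (germ_pullback \<rho>) a * fls_map (germ_pullback \<rho>) b"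
proof (rule fls_eqI)
  fix n
  have *: "\<forall>i<fls_subdegree a. fls_nth a i = 0" "\<forall>i<fls_subdegree b. fls_nth b i = 0"
    by simp_all
  then have "\<forall>i<fls_subdegree a. fls_nth (fls_map (germ_pullback \<rho>) a) i = 0"
    "\<forall>i<fls_subdegree b. fls_nth (fls_map (germ_pullback \<rho>) b) i = 0"
    by (simp_all add: fls_nth_fls_map_pullback)
  from fls_times_nth_bounds[OF this, of n] fls_times_nth_bounds[OF *, of n]
  show "fls_nth (fls_map (germ_pullback \<rho>) (a * b)) n
      = fls_nth (fls_map (germ_pullback \<rho>) a * fls_map (germ_pullback \<rho>) b) n"
    by (simp add: fls_nth_fls_map_pullback germ_pullback_sum germ_pullback_mult)
qed

lemma fls_map_pullback_sum:
  "fls_map (germ_pullback \<rho>) (\<Sum>k\<in>K. f k) = (\<Sum>k\<in>K. fls_map (germ_pullback \<rho>) (f k))"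
  by (rule fls_eqI) (simp add: fls_nth_fls_map_pullback fls_nth_sum germ_pullback_sum)

lemma vect_pullback_comb:
  "vect_pullback \<rho> (comb c u)
    = comb (\<lambda>j. fls_map (germ_pullback \<rho>) (c j)) (\<lambda>j. vect_pullback \<rho> (u j))"
  by (simp add: vect_pullback_def comb_def fls_map_pullback_sum fls_map_pullback_mult)

section \<open>The generators of the Brieskorn modules\<close>

lemma fls_nth_v0:
  "fls_nth (v0 h l :: 'n::finite germ fls) n =
    (if l = 0 \<and> n = 0 then 1
     else if l \<in> {1..CARD('n)} \<and> n = int l - 1 then coord l
     else if l = 2 \<and> n = 0 then series_germ h else 0)"
proof -
  have "(\<Sum>j=1..CARD('n). fls_const (coord j :: 'n germ) * Dt (1 - int j) * hframe j l)
      = (if l \<in> {1..CARD('n)} then fls_const (coord l) * Dt (1 - int l) else 0)"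
    by (simp add: hframe_def if_distrib cong: if_cong)
  then show ?thesis
    by (auto simp: v0_def hframe_def fls_nth_Dt)
qed

lemma fls_nth_vgen:
  assumes "j \<in> {1..CARD('n)}" "fps_conv_radius h > 0"
  shows "fls_nth (vgen h j l :: 'n::finite germ fls) n =
    (if l = j \<and> n = int j then 1
     else if j = 1 \<and> l = 2 \<and> n = 1 then series_germ (fps_deriv h) else 0)"
proof -
  have "fls_nth (vgen h j l :: 'n germ fls) n = germ_pd j (fls_nth (v0 h l) (n - 1))"
    using assms(1)
    by (simp add: vgen_def Dt_def pd_act_def fls_X_intpow_times_conv_shift fls_nth_fls_map)
  with assms germ_pd_coord[OF assms(1)] germ_pd_series[OF assms] show ?thesis
    by (auto simp: fls_nth_v0)
qed

lemma vgen_in_GM: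
  assumes "CARD('n) \<ge> 2" "fps_conv_radius h > 0" "j \<le> CARD('n)"
  shows "vgen h j \<in> (GM :: 'n::finite vect set)"
proof -
  have deriv: "fps_conv_radius (fps_deriv h) > 0"
    using fps_conv_radius_deriv[of h] assms(2) by simp
  have "vgen h j l \<in> (conv_laurent :: 'n germ fls set)" for l
  proof (rule conv_laurent_finite_support)
    show "fls_nth (vgen h j l :: 'n germ fls) n \<in> hol_germs" for n
      using assms
      by (cases "j = 0") (simp_all add: fls_nth_vgen vgen_def[of h 0] fls_nth_v0
          hol_germs_series[OF assms(2)] hol_germs_series[OF deriv])
    have "{n. fls_nth (vgen h j l :: 'n germ fls) n \<noteq> 0} \<subseteq> {0, int l - 1, int j, 1}"
      using assms by (cases "j = 0") (auto simp: fls_nth_vgen vgen_def[of h 0] fls_nth_v0 split: if_splits)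
    then show "finite {n. fls_nth (vgen h j l :: 'n germ fls) n \<noteq> 0}"
      by (rule finite_subset) simp
  qed
  moreover have "vgen h j l = (0 :: 'n germ fls)" if "l > CARD('n)" for l
    using assms that by (intro fls_eqI) (cases "j = 0"; simp add: fls_nth_vgen vgen_def[of h 0] fls_nth_v0)
  ultimately show ?thesis
    by (auto simp: GM_def)
qed

lemma Brieskorn_subset_GM:
  assumes "CARD('n) \<ge> 2" "fps_conv_radius h > 0"
  shows "Brieskorn h \<subseteq> (GM :: 'n::finite vect set)"
  unfolding Brieskorn_def using assms
  by (auto intro!: GM_comb vgen_in_GM conv_series_subset_laurent)

lemma vgen_in_Brieskorn:
  assumes "j \<le> CARD('n)"
  shows "(vgen h j :: 'n::finite vect) \<in> Brieskorn h"
proof -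
  have "comb (\<lambda>i. if i = j then 1 else 0) (vgen h) = (vgen h j :: 'n vect)"
    using assms by (intro ext) (simp add: comb_def if_distrib[of "\<lambda>x. x * _"] cong: if_cong)
  moreover have "0 \<in> (conv_series :: 'n germ fls set)"
    using conv_series_monomial[of 0 0] by simp
  ultimately show ?thesis
    unfolding Brieskorn_def using conv_series_1
    by (intro CollectI exI[of _ "\<lambda>i. if i = j then 1 else 0"]) auto
qed

text \<open>Because \<open>h\<close> and \<open>h'\<close> vanish at \<open>0\<close>, the generators specialize to \<open>\<partial>\<^sub>t\<^sup>-\<^sup>j e\<^sub>j\<close> at \<open>s = 0\<close>.\<close>

lemma germ_value_vgen:
  assumes "j \<le> CARD('n)" "fps_conv_radius h > 0" "fps_nth h 0 = 0" "fps_nth h 1 = 0"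
  shows "germ_value (fls_nth (vgen h j l :: 'n::finite germ fls) n) = (if l = j \<and> n = int j then 1 else 0)"
proof (cases "j = 0")
  case True
  then show ?thesis using assms(3) by (simp add: vgen_def fls_nth_v0)
next
  case False
  then show ?thesis using assms by (simp add: fls_nth_vgen)
qed

lemma Brieskorn_pullbackE:
  fixes u :: "'n::finite vect"
  assumes "u \<in> Brieskorn_pullback \<rho> h"
  obtains a where "\<And>j n. j \<le> CARD('n) \<Longrightarrow> n < 0 \<Longrightarrow> fls_nth (a j) n = 0"
    "u = comb a (\<lambda>j. vect_pullback \<rho> (vgen h j))"
proof -
  from assms obtain F f where F: "u = (\<lambda>l. \<Sum>x\<in>F. f x * x l)"
    "F \<subseteq> vect_pullback \<rho> ` Brieskorn h" "\<And>x. x \<in> F \<Longrightarrow> f x \<in> conv_series"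
    unfolding Brieskorn_pullback_def series_span_def by blast
  have "\<forall>x\<in>F. \<exists>c. (\<forall>j\<le>CARD('n). c j \<in> conv_series) \<and> x = vect_pullback \<rho> (comb c (vgen h))"
    using F(2) unfolding Brieskorn_def by blast
  then obtain c where c: "\<And>x j. x \<in> F \<Longrightarrow> j \<le> CARD('n) \<Longrightarrow> c x j \<in> conv_series"
    "\<And>x. x \<in> F \<Longrightarrow> x = vect_pullback \<rho> (comb (c x) (vgen h))"
    by metis
  define a where "a = (\<lambda>j. \<Sum>x\<in>F. f x * fls_map (germ_pullback \<rho>) (c x j))"
  show ?thesis
  proof (rule that[of a])
    fix j n assume j: "j \<le> CARD('n)" and n: "n < (0 :: int)"
    have "fls_nth (f x * fls_map (germ_pullback \<rho>) (c x j)) n = 0" if x: "x \<in> F" for x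
      by (rule fls_times_nth_nonneg(2)[OF _ _ n])
         (use F(3)[OF x] c(1)[OF x j] in \<open>simp_all add: conv_series_nth_neg fls_nth_fls_map_pullback\<close>)
    then show "fls_nth (a j) n = 0"
      by (simp add: a_def fls_nth_sum)
  next
    show "u = comb a (\<lambda>j. vect_pullback \<rho> (vgen h j))"
    proof
      fix l
      have "u l = (\<Sum>x\<in>F. f x * vect_pullback \<rho> (comb (c x) (vgen h)) l)"
        unfolding F(1) using c(2) by (intro sum.cong) auto
      also have "\<dots> = (\<Sum>x\<in>F. \<Sum>j\<le>CARD('n). f x * fls_map (germ_pullback \<rho>) (c x j) * vect_pullback \<rho> (vgen h j) l)"
        by (simp add: vect_pullback_comb) (simp add: comb_def sum_distrib_left mult.assoc)
      also have "\<dots> = comb a (\<lambda>j. vect_pullback \<rho> (vgen h j)) l"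
        by (subst sum.swap) (simp add: comb_def a_def sum_distrib_right)
      finally show "u l = comb a (\<lambda>j. vect_pullback \<rho> (vgen h j)) l" .
    qed
  qed
qed

text \<open>The value at \<open>0\<close> of a section of the pulled back module lies in the span of the
  \<open>\<partial>\<^sub>t\<^sup>-\<^sup>l e\<^sub>l\<close> because \<open>\<rho>\<close> fixes the origin.\<close>

lemma germ_value_Brieskorn_pullback:
  fixes u :: "'n::finite vect"
  assumes "germ_biholomorphism \<rho>" "fps_conv_radius h > 0" "fps_nth h 0 = 0" "fps_nth h 1 = 0"
    and "u \<in> Brieskorn_pullback \<rho> h" "n < l"
  shows "germ_value (fls_nth (u l) (int n)) = 0"
proof -
  from assms(5) obtain a where a: "\<And>j n. j \<le> CARD('n) \<Longrightarrow> n < 0 \<Longrightarrow> fls_nth (a j) n = 0"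
    "u = comb a (\<lambda>j. vect_pullback \<rho> (vgen h j))"
    by (rule Brieskorn_pullbackE) blast
  have "germ_value (fls_nth (a j * vect_pullback \<rho> (vgen h j) l) (int n)) = 0" if j: "j \<le> CARD('n)" for j
  proof -
    have neg: "\<forall>i<0. fls_nth (vect_pullback \<rho> (vgen h j) l) i = 0"
      using j assms(2) by (cases "j = 0")
        (auto simp: vect_pullback_def fls_nth_fls_map_pullback fls_nth_vgen vgen_def[of h 0] fls_nth_v0)
    have val: "germ_value (fls_nth (vect_pullback \<rho> (vgen h j) l) m) = (if l = j \<and> m = int j then 1 else 0)" for m
      unfolding vect_pullback_def fls_nth_fls_map_pullback germ_value_pullback[OF assms(1)]
      by (rule germ_value_vgen[OF j assms(2-4)])
    show ?thesis
      using a(1)[OF j] neg assms(6)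
      by (subst fls_times_nth_nonneg(1)) (auto simp: germ_value_sum val intro!: sum.neutral)
  qed
  then show ?thesis
    by (simp add: a(2) comb_def fls_nth_sum germ_value_sum)
qed

text \<open>The matrix of the pulled back generators is triangular with diagonal entries \<open>\<partial>\<^sub>t\<^sup>-\<^sup>j\<close>. If two
  sections agree in the degrees \<open>n \<ge> l\<close> of each component \<open>l\<close>, the coefficients of their difference
  with respect to the generators therefore vanish one after the other. This expresses that the filtration of \<open>H\<close> by the spans of
  the \<open>e\<^sub>i\<close> with \<open>i \<ge> p\<close> is opposite to the one that the Brieskorn module defines.\<close>

lemma Brieskorn_pullback_eqI:
  fixes u u' :: "'n::finite vect"
  assumes "germ_biholomorphism \<rho>" "fps_conv_radius h > 0"
    and u: "u \<in> Brieskorn_pullback \<rho> h" "u' \<in> Brieskorn_pullback \<rho> h"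
    and eq: "\<And>l n. int l \<le> n \<Longrightarrow> fls_nth (u l) n = fls_nth (u' l) n"
  shows "u = u'"
proof -
  define W where "W = (\<lambda>j. vect_pullback \<rho> (vgen h j) :: 'n vect)"
  from u(1) obtain a where a: "\<And>j n. j \<le> CARD('n) \<Longrightarrow> n < 0 \<Longrightarrow> fls_nth (a j) n = 0" "u = comb a W"
    unfolding W_def by (rule Brieskorn_pullbackE) blast
  from u(2) obtain a' where a': "\<And>j n. j \<le> CARD('n) \<Longrightarrow> n < 0 \<Longrightarrow> fls_nth (a' j) n = 0" "u' = comb a' W"
    unfolding W_def by (rule Brieskorn_pullbackE) blast
  have diag: "W j j = fls_X ^ j" if "j \<le> CARD('n)" for j
    using that assms(1,2) germ_pullback_1[OF assms(1)]
    by (intro fls_eqI) (cases "j = 0"; simp add: W_def vect_pullback_def fls_nth_fls_map_pullback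
        fls_nth_vgen vgen_def[of h 0] fls_nth_v0)
  have upper: "W i j = 0" if "j < i" "i \<le> CARD('n)" for i j
    using that assms(2)
    by (intro fls_eqI) (auto simp: W_def vect_pullback_def fls_nth_fls_map_pullback fls_nth_vgen)
  have "a j - a' j = 0" if "j \<le> CARD('n)" for j
    using that
  proof (induction j rule: less_induct)
    case (less j)
    have "u j - u' j = (\<Sum>i\<le>CARD('n). (a i - a' i) * W i j)"
      by (simp add: a(2) a'(2) comb_def left_diff_distrib sum_subtractf)
    also have "\<dots> = (\<Sum>i\<in>{j}. (a i - a' i) * W i j)"
    proof (rule sum.mono_neutral_right)
      show "\<forall>i\<in>{..CARD('n)} - {j}. (a i - a' i) * W i j = 0"
      proof
        fix i assume "i \<in> {..CARD('n)} - {j}"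
        then show "(a i - a' i) * W i j = 0"
          using less.IH[of i] upper[of j i] by (cases "i < j") auto
      qed
    qed (use less.prems in auto)
    finally have "u j - u' j = fls_X ^ j * (a j - a' j)"
      using diag[OF less.prems] by (simp add: mult.commute)
    then have shift: "fls_nth (u j) (n + int j) - fls_nth (u' j) (n + int j) = fls_nth (a j - a' j) n" for n
      by (metis fls_X_power_times_conv_shift(1) fls_minus_nth fls_shift_nth
          add.right_inverse add.assoc add.right_neutral)
    show ?case
    proof (rule fls_eqI)
      fix n
      show "fls_nth (a j - a' j) n = fls_nth 0 n"
        using shift[of n] eq[of j "n + int j"] a(1)[OF less.prems, of n] a'(1)[OF less.prems, of n]
        by (cases "n < 0") auto
    qed
  qed
  then show ?thesis
    by (simp add: a(2) a'(2) comb_def)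
qed

section \<open>Isomorphisms in terms of constant matrices\<close>

text \<open>Comparing coefficients of \<open>\<partial>\<^sub>t\<^sup>-\<^sup>n\<^sup>-\<^sup>1\<close> in \<open>t u = \<partial>\<^sub>t\<^sup>-\<^sup>1 u\<close> gives \<open>(n + 1) u\<^sub>n = u\<^sub>n\<close>, so \<open>u\<close> has
  degree \<open>0\<close>; the vanishing of all \<open>\<partial>\<^sub>s u\<close> then makes it constant.\<close>

lemma horizontal_imp_constant:
  fixes u :: "'n::finite vect"
  assumes "u \<in> GM" "t_act u = (\<lambda>l. fls_X * u l)"
    and "\<And>i. i \<in> {1..CARD('n)} \<Longrightarrow> pd_act i u = (\<lambda>_. 0)"
  shows "\<exists>x. u = comb (\<lambda>j. cst (x j)) hframe"
proof -
  have nonzero: "fls_nth (u l) n = 0" if "n \<noteq> 0" for l n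
  proof -
    have "of_int (n + 1) * fls_nth (u l) n = fls_nth (u l) n"
      using fls_nth_t_act[of u l n] by (simp add: assms(2) fls_X_times_conv_shift)
    then have "of_int n * fls_nth (u l) n = 0"
      by (simp add: algebra_simps)
    then show ?thesis
      using that by (rule of_int_mult_germ_eq_0)
  qed
  have "\<exists>c. fls_nth (u l) 0 = const_germ c" for l
  proof (rule hol_germ_constI)
    show "fls_nth (u l) 0 \<in> hol_germs"
      using assms(1) by (simp add: GM_def conv_laurent_nth_hol)
    fix i assume "i \<in> {1..CARD('n)}"
    then have "fls_nth (fls_map (germ_pd i) (u l)) 0 = 0"
      using fun_cong[OF assms(3), of i l] by (simp add: pd_act_def)
    then show "germ_pd i (fls_nth (u l) 0) = 0"
      by (simp add: fls_nth_fls_map)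
  qed
  then obtain x where x: "\<And>l. fls_nth (u l) 0 = const_germ (x l)"
    by metis
  have "u l = cst (x l)" for l
    by (rule fls_eqI) (simp add: cst_eq x nonzero)
  then have "u = comb (\<lambda>j. cst (x j)) hframe"
    using comb_hframe_GM[OF assms(1)] by (metis ext)
  then show ?thesis by (intro exI[of _ x])
qed

locale gm_isomorphism =
  fixes h h\<^sub>2 :: "complex fps"
    and \<rho> :: "complex ^ 'n::finite \<Rightarrow> complex ^ 'n"
    and \<phi> :: "'n vect \<Rightarrow> 'n vect"
  assumes card: "CARD('n) \<ge> 2"
    and h: "fps_conv_radius h > 0" "fps_nth h 0 = 0" "fps_nth h 1 = 0"
    and h\<^sub>2: "fps_conv_radius h\<^sub>2 > 0" "fps_nth h\<^sub>2 0 = 0" "fps_nth h\<^sub>2 1 = 0"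
    and iso: "GM_isomorphism h h\<^sub>2 \<rho> \<phi>"
begin

lemma biholomorphism: "germ_biholomorphism \<rho>"
  using iso by (simp add: GM_isomorphism_def)

lemma \<phi>_in_GM: "u \<in> GM \<Longrightarrow> \<phi> u \<in> GM"
  using iso bij_betw_apply[of \<phi> GM GM u] unfolding GM_isomorphism_def by blast

lemma \<phi>_eqD: "u \<in> GM \<Longrightarrow> w \<in> GM \<Longrightarrow> \<phi> u = \<phi> w \<Longrightarrow> u = w"
  using iso unfolding GM_isomorphism_def bij_betw_def by (meson inj_onD)

lemma \<phi>_Brieskorn: "\<phi> ` Brieskorn h = Brieskorn_pullback \<rho> h\<^sub>2"
  using iso by (simp add: GM_isomorphism_def)

lemma \<phi>_add: "u \<in> GM \<Longrightarrow> w \<in> GM \<Longrightarrow> \<phi> (\<lambda>l. u l + w l) = (\<lambda>l. \<phi> u l + \<phi> w l)"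
  using iso by (simp add: GM_isomorphism_def)

lemma \<phi>_scale: "a \<in> conv_laurent \<Longrightarrow> u \<in> GM \<Longrightarrow> \<phi> (\<lambda>l. a * u l) = (\<lambda>l. a * \<phi> u l)"
  using iso by (simp add: GM_isomorphism_def)

lemma \<phi>_zero: "\<phi> (\<lambda>_. 0) = (\<lambda>_. 0)"
  using \<phi>_scale[OF conv_laurent_0 GM_hframe[of 0]] by simp

lemma \<phi>_sum:
  assumes "finite K" "\<And>k. k \<in> K \<Longrightarrow> c k \<in> conv_laurent" "\<And>k. k \<in> K \<Longrightarrow> u k \<in> GM"
  shows "\<phi> (\<lambda>l. \<Sum>k\<in>K. c k * u k l) = (\<lambda>l. \<Sum>k\<in>K. c k * \<phi> (u k) l)"
  using assms
proof (induction K rule: finite_induct)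
  case (insert x K)
  have "\<phi> (\<lambda>l. c x * u x l + (\<Sum>k\<in>K. c k * u k l))
      = (\<lambda>l. \<phi> (\<lambda>l. c x * u x l) l + \<phi> (\<lambda>l. \<Sum>k\<in>K. c k * u k l) l)"
    using insert.prems by (intro \<phi>_add GM_sum GM_scale) auto
  with insert show ?case by (simp add: \<phi>_scale)
qed (simp add: \<phi>_zero)

lemma \<phi>_comb:
  assumes "\<And>k. k \<le> CARD('n) \<Longrightarrow> c k \<in> conv_laurent" "\<And>k. k \<le> CARD('n) \<Longrightarrow> u k \<in> GM"
  shows "\<phi> (comb c u) = comb c (\<lambda>k. \<phi> (u k))"
  unfolding comb_def by (rule \<phi>_sum) (use assms in auto)

lemma \<phi>_hframe_constant:
  assumes "i \<le> CARD('n)"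
  shows "\<exists>x. \<phi> (hframe i) = comb (\<lambda>j. cst (x j)) hframe"
proof (rule horizontal_imp_constant)
  have GM: "hframe i \<in> (GM :: 'n vect set)"
    using assms by (rule GM_hframe)
  then show "\<phi> (hframe i) \<in> GM"
    by (rule \<phi>_in_GM)
  have X: "(fls_X :: 'n germ fls) \<in> conv_laurent"
    using conv_series_subset_laurent[OF conv_series_X_power[of 1]] by simp
  have "t_act (hframe i) = (\<lambda>l. fls_X * hframe i l :: 'n germ fls)"
    by (auto simp: t_act_def hframe_def)
  moreover have "\<phi> (t_act (hframe i)) = t_act (\<phi> (hframe i))"
    using iso GM unfolding GM_isomorphism_def by blast
  ultimately show "t_act (\<phi> (hframe i)) = (\<lambda>l. fls_X * \<phi> (hframe i) l)"
    using \<phi>_scale[OF X GM] by simp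
  fix k assume k: "k \<in> {1..CARD('n)}"
  have "pd_act k (hframe i) = (\<lambda>_. 0 :: 'n germ fls)"
    by (intro ext fls_eqI) (simp add: pd_act_def hframe_def fls_nth_fls_map)
  then show "pd_act k (\<phi> (hframe i)) = (\<lambda>_. 0)"
    using iso GM k \<phi>_zero unfolding GM_isomorphism_def by metis
qed

lemma \<phi>_hframe:
  assumes "i \<le> CARD('n)"
  shows "\<phi> (hframe i) = comb (\<lambda>j. cst (frame_matrix \<phi> i j)) hframe"
proof -
  define P where "P = (\<lambda>A :: nat \<Rightarrow> nat \<Rightarrow> complex. (\<forall>i j. i > CARD('n) \<or> j > CARD('n) \<longrightarrow> A i j = 0) \<and>
      (\<forall>i\<le>CARD('n). \<phi> (hframe i) = comb (\<lambda>j. cst (A i j)) hframe))"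
  from \<phi>_hframe_constant obtain x where
    x: "\<And>i. i \<le> CARD('n) \<Longrightarrow> \<phi> (hframe i) = comb (\<lambda>j. cst (x i j)) hframe"
    by metis
  have "P (\<lambda>i j. if i \<le> CARD('n) \<and> j \<le> CARD('n) then x i j else 0)"
    unfolding P_def by (auto simp: x comb_hframe)
  moreover have "A = B" if A: "P A" and B: "P B" for A B
  proof (intro ext)
    fix i j
    show "A i j = B i j"
    proof (cases "i \<le> CARD('n) \<and> j \<le> CARD('n)")
      case True
      then have "comb (\<lambda>j. cst (A i j)) hframe j = (comb (\<lambda>j. cst (B i j)) hframe j :: 'n germ fls)"
        using A B unfolding P_def by metis
      with True show ?thesis by (simp add: comb_hframe)
    next
      case False
      then show ?thesis using A B unfolding P_def by (metis linorder_not_le)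
    qed
  qed
  ultimately have "\<exists>!A. P A"
    by blast
  then have "P (THE A. P A)"
    by (rule theI')
  with assms show ?thesis
    unfolding P_def frame_matrix_def by blast
qed

text \<open>Compare fibres at the origin: the image of \<open>v\<^sub>i\<close> there is \<open>\<partial>\<^sub>t\<^sup>-\<^sup>i \<phi>(e\<^sub>i)\<close>, and it has to lie in
  the span of the \<open>\<partial>\<^sub>t\<^sup>-\<^sup>j e\<^sub>j\<close> over the power series.\<close>

lemma frame_matrix_lower_triangular:
  assumes "i < j" "j \<le> CARD('n)"
  shows "frame_matrix \<phi> i j = 0"
proof -
  define A where "A = frame_matrix \<phi>"
  have i: "i \<le> CARD('n)"
    using assms by simp
  have GM: "vgen h i \<in> (GM :: 'n vect set)"
    using card h(1) i by (rule vgen_in_GM)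
  have "\<phi> (vgen h i) = \<phi> (comb (vgen h i) hframe)"
    by (simp add: comb_hframe_GM[OF GM])
  also have "\<dots> = comb (vgen h i) (\<lambda>k. \<phi> (hframe k))"
    using GM by (intro \<phi>_comb GM_hframe) (auto simp: GM_def)
  finally have "\<phi> (vgen h i) j = (\<Sum>k\<le>CARD('n). vgen h i k * cst (A k j))"
    using assms(2) by (simp add: comb_def[of "vgen h i"] \<phi>_hframe comb_hframe A_def)
  then have "germ_value (fls_nth (\<phi> (vgen h i) j) (int i))
      = (\<Sum>k\<le>CARD('n). germ_value (fls_nth (vgen h i k :: 'n germ fls) (int i)) * A k j)"
    by (simp add: fls_nth_sum germ_value_sum cst_eq)
  also have "\<dots> = A i j"
    using i by (simp add: germ_value_vgen[OF i h] if_distrib[of "\<lambda>x. x * _"] cong: if_cong)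
  also have "germ_value (fls_nth (\<phi> (vgen h i) j) (int i)) = 0"
    by (rule germ_value_Brieskorn_pullback[OF biholomorphism h\<^sub>2 _ assms(1)])
       (use vgen_in_Brieskorn[OF i] \<phi>_Brieskorn in blast)
  finally show ?thesis by (simp add: A_def)
qed

end

section \<open>The second basis\<close>

locale gm_isomorphism_basis = gm_isomorphism h h\<^sub>2 \<rho> \<phi>
  for h h\<^sub>2 and \<rho> :: "complex ^ 'n::finite \<Rightarrow> complex ^ 'n" and \<phi> +
  fixes b :: "nat \<Rightarrow> nat \<Rightarrow> complex"
  assumes unit_diagonal: "\<forall>i\<le>CARD('n). frame_matrix \<phi> i i = 1"
    and basis: "H_basis_change CARD('n) (frame_matrix \<phi>) b"
begin

abbreviation B :: "nat \<Rightarrow> 'n vect" where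
  "B i \<equiv> H_vect (b i)"

lemma B_in_GM: "i \<le> CARD('n) \<Longrightarrow> B i \<in> GM"
  using basis by (auto simp: GM_def H_vect_def conv_laurent_cst H_basis_change_def H_space_def)

text \<open>The relations \<open>e\<^sub>i = \<Sum>\<^sub>j\<^sub>\<le>\<^sub>i A\<^sub>i\<^sub>j b\<^sub>j\<close> define the \<open>b\<^sub>j\<close> exactly so that \<open>\<phi>\<close> carries them to the
  frame of the target. Applying \<open>\<phi>\<close> to them and comparing with \<open>\<phi>(e\<^sub>i) = \<Sum>\<^sub>j\<^sub>\<le>\<^sub>i A\<^sub>i\<^sub>j e\<^sub>j\<close> gives this by
  induction, since the coefficient of the last summand is \<open>A\<^sub>i\<^sub>i = 1\<close>.\<close>

lemma \<phi>_B: "i \<le> CARD('n) \<Longrightarrow> \<phi> (B i) = hframe i"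
proof (induction i rule: less_induct)
  case (less i)
  define A where "A = frame_matrix \<phi>"
  have split: "{..i} = insert i {..<i}"
    by auto
  have "(\<lambda>l. if l = i then 1 else 0) = (\<lambda>l. \<Sum>j\<le>i. A i j * b j l)"
    using basis less.prems by (simp add: H_basis_change_def A_def)
  then have "hframe i l = cst (\<Sum>j\<le>i. A i j * b j l)" for l
    by (metis (mono_tags, lifting) hframe_def cst_0 cst_1)
  then have "hframe i = (\<lambda>l. \<Sum>j\<le>i. cst (A i j) * B j l)"
    by (intro ext) (simp add: H_vect_def cst_sum cst_mult)
  moreover have "\<phi> (\<lambda>l. \<Sum>j\<le>i. cst (A i j) * B j l) = (\<lambda>l. \<Sum>j\<le>i. cst (A i j) * \<phi> (B j) l)"
    by (rule \<phi>_sum) (use less.prems in \<open>auto intro: conv_laurent_cst B_in_GM\<close>)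
  ultimately have "\<phi> (hframe i) = (\<lambda>l. \<Sum>j\<le>i. cst (A i j) * \<phi> (B j) l)"
    by simp
  then have eq: "comb (\<lambda>j. cst (A i j)) hframe = (\<lambda>l. \<Sum>j\<le>i. cst (A i j) * \<phi> (B j) l)"
    using \<phi>_hframe[OF less.prems] by (simp add: A_def)
  have "\<phi> (B i) l = hframe i l" for l
  proof -
    have "comb (\<lambda>j. cst (A i j)) hframe l = (\<Sum>j\<le>i. cst (A i j) * hframe j l :: 'n germ fls)"
      unfolding comb_def using less.prems frame_matrix_lower_triangular
      by (intro sum.mono_neutral_right) (auto simp: A_def)
    with fun_cong[OF eq, of l] show ?thesis
      using less unit_diagonal by (simp add: split A_def)
  qed
  then show ?case ..
qed

lemma \<phi>_comb_B:
  assumes "\<And>i. i \<le> CARD('n) \<Longrightarrow> c i \<in> conv_laurent"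
  shows "\<phi> (comb c B) = (\<lambda>l. if l \<le> CARD('n) then c l else 0)"
proof -
  have "\<phi> (comb c B) = comb c (\<lambda>i. \<phi> (B i))"
    using assms by (intro \<phi>_comb B_in_GM)
  also have "\<dots> = comb c hframe"
    by (simp add: comb_def \<phi>_B)
  finally show ?thesis by (simp add: comb_hframe)
qed

text \<open>Applying \<open>\<phi>\<close> to the expansion of \<open>b\<^sub>j\<close> in the \<open>e\<^sub>i\<close> shows that the matrix of \<open>\<phi>\<close> is also a right
  inverse of \<open>(b\<^sub>j)\<close>. With it the coefficients of a combination can be recovered even if they do
  not converge; to such combinations \<open>\<phi>\<close> cannot be applied.\<close>

lemma comb_B_inject:
  assumes "comb c B = comb c' B" "i \<le> CARD('n)"
  shows "c i = c' i"
proof -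
  define A where "A = frame_matrix \<phi>"
  have inv: "(\<Sum>l\<le>CARD('n). B j l * cst (A l i)) = (if i = j then 1 else 0)" if "j \<le> CARD('n)" for j
  proof -
    have GM: "B j \<in> GM"
      using that by (rule B_in_GM)
    have "hframe j = \<phi> (comb (B j) hframe)"
      by (simp add: comb_hframe_GM[OF GM] \<phi>_B that)
    also have "\<dots> = comb (B j) (\<lambda>l. \<phi> (hframe l))"
      using GM by (intro \<phi>_comb GM_hframe) (auto simp: GM_def)
    finally have "hframe j i = (\<Sum>l\<le>CARD('n). B j l * cst (A l i))"
      using assms(2) by (simp add: comb_def[of "B j"] \<phi>_hframe comb_hframe A_def)
    then show ?thesis
      by (simp add: hframe_def)
  qed
  have "(\<Sum>l\<le>CARD('n). comb d B l * cst (A l i)) = d i" for d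
  proof -
    have "(\<Sum>l\<le>CARD('n). comb d B l * cst (A l i))
        = (\<Sum>j\<le>CARD('n). d j * (\<Sum>l\<le>CARD('n). B j l * cst (A l i)))"
      unfolding comb_def sum_distrib_left sum_distrib_right mult.assoc by (rule sum.swap)
    also have "\<dots> = d i"
      using assms(2) by (simp add: inv if_distrib cong: if_cong)
    finally show ?thesis .
  qed
  with assms(1) show ?thesis by metis
qed

lemma frame_coeff_comb:
  assumes "\<forall>i>CARD('n). c i = 0"
  shows "frame_coeff b (comb c B) m j = fls_nth (c j) (- m)"
proof -
  have "(THE c'. (\<forall>i>CARD('n). c' i = 0) \<and> comb c B = comb c' B) = c"
  proof (rule the_equality)
    fix c' assume c': "(\<forall>i>CARD('n). c' i = 0) \<and> comb c B = comb c' B"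
    show "c' = c"
    proof
      fix i
      show "c' i = c i"
        using c' assms comb_B_inject[of c c' i] by (cases "i \<le> CARD('n)") auto
    qed
  qed (use assms in simp)
  then show ?thesis by (simp add: frame_coeff_def)
qed

section \<open>The canonical generator\<close>

text \<open>The components of \<open>b\<^sub>0 + \<Sum>\<^sub>k\<^sub>\<le>\<^sub>i c\<^sub>k\<^sub>i \<partial>\<^sub>t\<^sup>1\<^sup>-\<^sup>k b\<^sub>i\<close> with respect to the \<open>b\<^sub>i\<close>: the normal form of the
  canonical generator.\<close>

definition canonical_coeffs :: "(nat \<Rightarrow> nat \<Rightarrow> 'n germ) \<Rightarrow> nat \<Rightarrow> 'n germ fls" where
  "canonical_coeffs c i = (if i = 0 then 1 else \<Sum>k=1..i. fls_const (c k i) * Dt (1 - int k))"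

lemma fls_nth_canonical_coeffs:
  "fls_nth (canonical_coeffs c i) n =
    (if i = 0 \<and> n = 0 then 1 else if 0 \<le> n \<and> n < int i then c (nat n + 1) i else 0)"
proof (cases "i = 0")
  case False
  have "fls_nth (canonical_coeffs c i) n = (\<Sum>k=1..i. if k = nat n + 1 \<and> 0 \<le> n then c k i else 0)"
    using False unfolding canonical_coeffs_def
    by (auto simp: fls_nth_sum fls_nth_Dt intro!: sum.cong)
  also have "\<dots> = (if 0 \<le> n \<and> n < int i then c (nat n + 1) i else 0)"
    by (cases "0 \<le> n") (auto simp: nat_less_iff)
  finally show ?thesis using False by simp
qed (simp add: canonical_coeffs_def)

lemma canonical_form_iff:
  "(\<forall>l. v l - B 0 l = (\<Sum>k=1..CARD('n). \<Sum>i=k..CARD('n). fls_const (c k i) * Dt (1 - int k) * B i l))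
    \<longleftrightarrow> v = comb (canonical_coeffs c) B"
proof -
  have "(\<Sum>k=1..CARD('n). \<Sum>i=k..CARD('n). fls_const (c k i) * Dt (1 - int k) * B i l)
      = comb (canonical_coeffs c) B l - B 0 l" for l
  proof -
    have "(\<Sum>k=1..CARD('n). \<Sum>i=k..CARD('n). fls_const (c k i) * Dt (1 - int k) * B i l)
        = (\<Sum>i=1..CARD('n). \<Sum>k=1..i. fls_const (c k i) * Dt (1 - int k) * B i l)"
      unfolding sum.Sigma[OF finite_atLeastAtMost ballI[OF finite_atLeastAtMost]]
      by (rule sum.reindex_bij_witness[of _ "\<lambda>(i, k). (k, i)" "\<lambda>(k, i). (i, k)"]) auto
    also have "\<dots> = (\<Sum>i=1..CARD('n). canonical_coeffs c i * B i l)"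
      by (intro sum.cong) (auto simp: canonical_coeffs_def sum_distrib_right)
    also have "\<dots> = comb (canonical_coeffs c) B l - B 0 l"
      by (simp add: comb_def atMost_atLeast0 sum.atLeast_Suc_atMost[of 0] canonical_coeffs_def[of _ 0])
    finally show ?thesis .
  qed
  then show ?thesis by (auto simp: fun_eq_iff)
qed

lemma canonical_coeffs_conv:
  assumes "\<forall>k\<in>{1..CARD('n)}. \<forall>i\<in>{k..CARD('n)}. c k i \<in> hol_germs" "i \<le> CARD('n)"
  shows "canonical_coeffs c i \<in> conv_laurent"
  unfolding canonical_coeffs_def using assms
  by (auto intro!: conv_laurent_1 conv_laurent_sum conv_laurent_mult conv_laurent_const conv_laurent_Dt)

text \<open>In a normal form the coefficients of \<open>\<partial>\<^sub>t\<^sup>-\<^sup>n b\<^sub>l\<close> with \<open>n \<ge> l\<close> do not depend on \<open>c\<close>, and after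
  applying \<open>\<phi>\<close> these coefficients determine a section of the pulled back module.\<close>

lemma canonical_form_unique:
  assumes c: "\<forall>k\<in>{1..CARD('n)}. \<forall>i\<in>{k..CARD('n)}. c k i \<in> hol_germs"
    and d: "\<forall>k\<in>{1..CARD('n)}. \<forall>i\<in>{k..CARD('n)}. d k i \<in> hol_germs"
    and "comb (canonical_coeffs c) B \<in> Brieskorn h" "comb (canonical_coeffs d) B \<in> Brieskorn h"
  shows "comb (canonical_coeffs c) B = comb (canonical_coeffs d) B"
proof (rule \<phi>_eqD)
  show "comb (canonical_coeffs c) B \<in> GM" "comb (canonical_coeffs d) B \<in> GM"
    using assms Brieskorn_subset_GM[OF card h(1)] by auto
  show "\<phi> (comb (canonical_coeffs c) B) = \<phi> (comb (canonical_coeffs d) B)"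
  proof (rule Brieskorn_pullback_eqI[OF biholomorphism h\<^sub>2(1)])
    show "\<phi> (comb (canonical_coeffs c) B) \<in> Brieskorn_pullback \<rho> h\<^sub>2"
      "\<phi> (comb (canonical_coeffs d) B) \<in> Brieskorn_pullback \<rho> h\<^sub>2"
      using assms(3,4) \<phi>_Brieskorn by blast+
  qed (simp add: \<phi>_comb_B canonical_coeffs_conv[OF c] canonical_coeffs_conv[OF d]
      fls_nth_canonical_coeffs)
qed

text \<open>The \<open>c\<^sub>k\<^sub>i\<close> for which the normal form has the components of \<open>\<rho>\<^sup>*v\<^sub>0\<close>: the coordinates on the
  diagonal, and \<open>h\<^sub>2\<close> in the position of \<open>\<partial>\<^sub>t\<^sup>0 b\<^sub>2\<close>.\<close>

definition pulled_back_coeffs :: "nat \<Rightarrow> nat \<Rightarrow> 'n germ" where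
  "pulled_back_coeffs k i =
    (if i = k then germ_pullback \<rho> (coord k)
     else if k = 1 \<and> i = 2 then germ_pullback \<rho> (series_germ h\<^sub>2) else 0)"

lemma pulled_back_coeffs_hol: "pulled_back_coeffs k i \<in> hol_germs"
  by (simp add: pulled_back_coeffs_def hol_germs_pullback[OF biholomorphism] hol_germs_series h\<^sub>2(1))

lemma vect_pullback_v0:
  "vect_pullback \<rho> (v0 h\<^sub>2) = (\<lambda>l. if l \<le> CARD('n) then canonical_coeffs pulled_back_coeffs l else 0)"
proof (intro ext fls_eqI)
  fix l n
  show "fls_nth (vect_pullback \<rho> (v0 h\<^sub>2) l) n
      = fls_nth (if l \<le> CARD('n) then canonical_coeffs pulled_back_coeffs l else 0) n"
    using card germ_pullback_1[OF biholomorphism]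
    by (auto simp: vect_pullback_def fls_nth_fls_map_pullback fls_nth_v0 fls_nth_canonical_coeffs
        pulled_back_coeffs_def nat_eq_iff of_nat_diff)
qed

text \<open>This is the preimage of \<open>\<rho>\<^sup>*v\<^sub>0\<close> under \<open>\<phi>\<close>, and \<open>\<phi>\<close> identifies the Brieskorn modules.\<close>

lemma pulled_back_v0_in_Brieskorn: "comb (canonical_coeffs pulled_back_coeffs) B \<in> Brieskorn h"
proof -
  have conv: "canonical_coeffs pulled_back_coeffs i \<in> conv_laurent" if "i \<le> CARD('n)" for i
    using that by (intro canonical_coeffs_conv) (simp_all add: pulled_back_coeffs_hol)
  have "v0 h\<^sub>2 \<in> (Brieskorn h\<^sub>2 :: 'n vect set)"
    using vgen_in_Brieskorn[of 0 h\<^sub>2] by (simp add: vgen_def)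
  then have "vect_pullback \<rho> (v0 h\<^sub>2) \<in> Brieskorn_pullback \<rho> h\<^sub>2"
    unfolding Brieskorn_pullback_def series_span_def
    by (intro CollectI exI[of _ "{vect_pullback \<rho> (v0 h\<^sub>2)}"] exI[of _ "\<lambda>_. 1"])
       (auto simp: conv_series_1)
  then obtain x where x: "x \<in> Brieskorn h" "\<phi> x = vect_pullback \<rho> (v0 h\<^sub>2)"
    using \<phi>_Brieskorn by (metis imageE)
  have "comb (canonical_coeffs pulled_back_coeffs) B = x"
  proof (rule \<phi>_eqD)
    show "comb (canonical_coeffs pulled_back_coeffs) B \<in> GM"
      by (intro GM_comb conv B_in_GM)
    show "x \<in> GM"
      using x(1) Brieskorn_subset_GM[OF card h(1)] by blast
  qed (simp add: x(2) \<phi>_comb_B conv vect_pullback_v0)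
  with x(1) show ?thesis by simp
qed

lemma canonical_generator_eq:
  "canonical_generator h b = comb (canonical_coeffs pulled_back_coeffs) B"
  unfolding canonical_generator_def canonical_form_iff
proof (rule the_equality)
  show "comb (canonical_coeffs pulled_back_coeffs) B \<in> Brieskorn h \<and>
      (\<exists>c. (\<forall>k\<in>{1..CARD('n)}. \<forall>i\<in>{k..CARD('n)}. c k i \<in> hol_germs) \<and>
        comb (canonical_coeffs pulled_back_coeffs) B = comb (canonical_coeffs c) B)"
    using pulled_back_v0_in_Brieskorn pulled_back_coeffs_hol
    by (intro conjI exI[of _ pulled_back_coeffs]) auto
next
  fix v assume "v \<in> Brieskorn h \<and>
    (\<exists>c. (\<forall>k\<in>{1..CARD('n)}. \<forall>i\<in>{k..CARD('n)}. c k i \<in> hol_germs) \<and> v = comb (canonical_coeffs c) B)"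
  then show "v = comb (canonical_coeffs pulled_back_coeffs) B"
    using canonical_form_unique pulled_back_v0_in_Brieskorn pulled_back_coeffs_hol by blast
qed

lemma frame_coeff_canonical_generator:
  assumes "i \<le> CARD('n)"
  shows "frame_coeff b (canonical_generator h b) m i = fls_nth (canonical_coeffs pulled_back_coeffs i) (- m)"
proof -
  have "canonical_generator h b
      = comb (\<lambda>l. if l \<le> CARD('n) then canonical_coeffs pulled_back_coeffs l else 0) B"
    by (simp add: canonical_generator_eq comb_def)
  then show ?thesis
    using assms by (simp add: frame_coeff_comb)
qed

end

theorem theorem2:
  fixes h h\<^sub>2 :: "complex fps"
    and \<rho> :: "complex ^ 'n::finite \<Rightarrow> complex ^ 'n"
    and \<phi> :: "'n vect \<Rightarrow> 'n vect"
    and b :: "nat \<Rightarrow> nat \<Rightarrow> complex"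
  assumes "CARD('n) \<ge> 2"
    and "fps_conv_radius h > 0" and "fps_nth h 0 = 0" and "fps_nth h 1 = 0"
    and "fps_conv_radius h\<^sub>2 > 0" and "fps_nth h\<^sub>2 0 = 0" and "fps_nth h\<^sub>2 1 = 0"
    and "GM_isomorphism h h\<^sub>2 \<rho> \<phi>"
    and "\<forall>i\<le>CARD('n). frame_matrix \<phi> i i = 1"
    and "H_basis_change CARD('n) (frame_matrix \<phi>) b"
  shows "(\<forall>j\<in>{1..CARD('n)}.
            frame_coeff b (canonical_generator h b) (1 - int j) j = germ_pullback \<rho> (coord j)) \<and>
         frame_coeff b (canonical_generator h b :: 'n vect) 0 2 = germ_pullback \<rho> (series_germ h\<^sub>2)"
proof -
  interpret gm_isomorphism_basis h h\<^sub>2 \<rho> \<phi> b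
    using assms by unfold_locales
  show ?thesis
    using assms(1)
    by (auto simp: frame_coeff_canonical_generator fls_nth_canonical_coeffs pulled_back_coeffs_def
        nat_diff_distrib)
qed

end
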